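(* Let $m\ge1$ and $n\ge 0$ be integers and define $$r(m,n)=\begin{cases} m^3-2m & \text{if } m \text{ is even and } n \text{ is odd},\\ \dfrac{(m-2)(m+1)^2}{2} & \text{otherwise.}\end{cases}$$ Suppose that $n>r(m,n)$. Then $T(m,n;1,2;s)$ is true for every integer $s\ge 0$ with $$s\leq\left\lfloor\frac{(m+1)\binom{n+2}{2}}{m+n+1}\right\rfloor .$$
   Context: Let $V$, $W$ be complex vector spaces of dimensions $m+1$, $n+1$. Let $X_{m,n}\subset\mathbb{P}(V\otimes S_2(W))$ be the Segre-Veronese variety $\mathbb{P}(V)\times\mathbb{P}(W)$ embedded by $\mathcal{O}(1,2)$, i.e. the set of points $[u\otimes v^2]$ with $u\in V\setminus\{0\}$, $v\in W\setminus\{0\}$. For $p=[u\otimes v^2]\in X_{m,n}$ let $T_p(X_{m,n})=V\otimes v^2+u\otimes vW\subset V\otimes S_2(W)$, the affine cone over the tangent space at $p$. The statement "$T(m,n;1,2;s)$ is true" means that for general points $p_1,\dots,p_s\in X_{m,n}$ the subspace $\sum_{i=1}^sT_{p_i}(X_{m,n})$ of $V\otimes S_2(W)$ has dimension $\min\{s(m+n+1),(m+1)\binom{n+2}{2}\}$. Equivalently (for $s\geq 1$, by Terracini's lemma), the $s$-th secant variety $\sigma_s(X_{m,n})$ (Zariski closure of the union of the linear spans of $s$-tuples of points of $X_{m,n}$) has the expected dimension $\min\{s(m+n+1),(m+1)\binom{n+2}{2}\}-1$. *)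

theory Defs
  imports Complex_Main "HOL-Library.Function_Algebras" "HOL-Library.Set_Algebras"
    "HOL-Library.FuncSet"
begin

text \<open>
  Complex vector spaces are modelled by spaces of functions \<open>'a \<Rightarrow> complex\<close> with pointwise
  operations (addition from \<^theory>\<open>HOL-Library.Function_Algebras\<close>).
\<close>

definition cscale :: "complex \<Rightarrow> ('a \<Rightarrow> complex) \<Rightarrow> 'a \<Rightarrow> complex" where
  "cscale c f = (\<lambda>x. c * f x)"

global_interpretation cfun: vector_space cscale
  by standard (auto simp: cscale_def fun_eq_iff algebra_simps)

text \<open>
  The standard model of a complex vector space of dimension \<open>d\<close>.  In what follows
  \<open>V = cspace (m + 1)\<close> and \<open>W = cspace (n + 1)\<close>.
\<close>

definition cspace :: "nat \<Rightarrow> (nat \<Rightarrow> complex) set" where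
  "cspace d = {u. \<forall>i\<ge>d. u i = 0}"

text \<open>
  The symmetric square \<open>S\<^sub>2(W)\<close> is realised by symmetric matrices, so that the product
  \<open>v w\<close> is the symmetrisation of \<open>v \<otimes> w\<close> and \<open>v\<^sup>2 = v \<otimes> v\<close>; an element of
  \<open>V \<otimes> S\<^sub>2(W)\<close> is the family of its coordinates \<open>t (i, j, k)\<close>, symmetric in \<open>j\<close> and \<open>k\<close>.
\<close>

definition sym_prod :: "(nat \<Rightarrow> complex) \<Rightarrow> (nat \<Rightarrow> complex) \<Rightarrow> nat \<times> nat \<Rightarrow> complex" where
  "sym_prod v w = (\<lambda>(j, k). (v j * w k + v k * w j) / 2)"

abbreviation sym_square :: "(nat \<Rightarrow> complex) \<Rightarrow> nat \<times> nat \<Rightarrow> complex" where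
  "sym_square v \<equiv> sym_prod v v"

type_synonym tensor = "nat \<times> nat \<times> nat \<Rightarrow> complex"

definition tens :: "(nat \<Rightarrow> complex) \<Rightarrow> (nat \<times> nat \<Rightarrow> complex) \<Rightarrow> tensor" where
  "tens u q = (\<lambda>(i, jk). u i * q jk)"

text \<open>A point \<open>[t]\<close> of projective space is the line spanned by \<open>t \<noteq> 0\<close>.\<close>

definition proj_point :: "('a \<Rightarrow> complex) \<Rightarrow> ('a \<Rightarrow> complex) set" where
  "proj_point t = cfun.span {t}"

definition segre_veronese :: "nat \<Rightarrow> nat \<Rightarrow> tensor set set" where
  "segre_veronese m n = {proj_point (tens u (sym_square v)) | u v.
     u \<in> cspace (m + 1) - {0} \<and> v \<in> cspace (n + 1) - {0}}"

definition tangent_at :: "nat \<Rightarrow> nat \<Rightarrow> (nat \<Rightarrow> complex) \<Rightarrow> (nat \<Rightarrow> complex) \<Rightarrow> tensor set" where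
  "tangent_at m n u v =
     (\<lambda>a. tens a (sym_square v)) ` cspace (m + 1) + (\<lambda>w. tens u (sym_prod v w)) ` cspace (n + 1)"

text \<open>
  The union is over all representations \<open>p = [u \<otimes> v\<^sup>2]\<close>; all of them yield the same space, see
  \<open>tangent_cone_eq\<close> below.
\<close>

definition tangent_cone :: "nat \<Rightarrow> nat \<Rightarrow> tensor set \<Rightarrow> tensor set" where
  "tangent_cone m n p = \<Union>{tangent_at m n u v | u v.
     u \<in> cspace (m + 1) - {0} \<and> v \<in> cspace (n + 1) - {0} \<and>
     p = proj_point (tens u (sym_square v))}"

text \<open>
  Polynomial functions on the \<open>s\<close>-fold product of \<open>V \<otimes> S\<^sub>2(W)\<close>, in the coordinates of the
  \<open>s\<close> factors, and those among them that are homogeneous in each factor separately.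
\<close>

inductive_set poly_funs :: "nat \<Rightarrow> nat \<Rightarrow> nat \<Rightarrow> ((nat \<Rightarrow> tensor) \<Rightarrow> complex) set"
  for m n s :: nat where
  const: "(\<lambda>_. c) \<in> poly_funs m n s"
| coord: "\<lbrakk>l < s; i \<le> m; j \<le> n; k \<le> n\<rbrakk> \<Longrightarrow> (\<lambda>x. x l (i, j, k)) \<in> poly_funs m n s"
| add: "\<lbrakk>F \<in> poly_funs m n s; G \<in> poly_funs m n s\<rbrakk> \<Longrightarrow> (\<lambda>x. F x + G x) \<in> poly_funs m n s"
| mult: "\<lbrakk>F \<in> poly_funs m n s; G \<in> poly_funs m n s\<rbrakk> \<Longrightarrow> (\<lambda>x. F x * G x) \<in> poly_funs m n s"

definition multihom_poly_funs :: "nat \<Rightarrow> nat \<Rightarrow> nat \<Rightarrow> ((nat \<Rightarrow> tensor) \<Rightarrow> complex) set" where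
  "multihom_poly_funs m n s = {F \<in> poly_funs m n s.
     \<exists>d :: nat \<Rightarrow> nat. \<forall>l<s. \<forall>c x. F (x(l := cscale c (x l))) = c ^ d l * F x}"

definition vanishes_at ::
    "nat \<Rightarrow> ((nat \<Rightarrow> tensor) \<Rightarrow> complex) \<Rightarrow> (nat \<Rightarrow> tensor set) \<Rightarrow> bool" where
  "vanishes_at s F p \<longleftrightarrow> (\<forall>x. (\<forall>l<s. x l \<in> p l) \<longrightarrow> F x = 0)"

text \<open>
  Zariski open subsets of the product variety \<open>X\<^sup>s\<close>, where \<open>X = segre_veronese m n\<close>: the
  complements of the common zero loci of sets of multihomogeneous polynomials.
\<close>

definition zariski_open :: "nat \<Rightarrow> nat \<Rightarrow> nat \<Rightarrow> (nat \<Rightarrow> tensor set) set \<Rightarrow> bool" where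
  "zariski_open m n s U \<longleftrightarrow> (\<exists>A \<subseteq> multihom_poly_funs m n s.
     U = {p \<in> {..<s} \<rightarrow>\<^sub>E segre_veronese m n. \<exists>F\<in>A. \<not> vanishes_at s F p})"

text \<open>
  A property holds for general points \<open>p\<^sub>0, \<dots>, p\<^sub>s\<^sub>-\<^sub>1\<close> of \<open>X\<close> if it holds on a nonempty
  Zariski open subset of the irreducible variety \<open>X\<^sup>s\<close>.
\<close>

definition for_general_points ::
    "nat \<Rightarrow> nat \<Rightarrow> nat \<Rightarrow> ((nat \<Rightarrow> tensor set) \<Rightarrow> bool) \<Rightarrow> bool" where
  "for_general_points m n s P \<longleftrightarrow> (\<exists>U. zariski_open m n s U \<and> U \<noteq> {} \<and> (\<forall>p\<in>U. P p))"

text \<open>The statement \<open>T(m,n;1,2;s)\<close>.\<close>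

definition T12 :: "nat \<Rightarrow> nat \<Rightarrow> nat \<Rightarrow> bool" where
  "T12 m n s \<longleftrightarrow> for_general_points m n s (\<lambda>p.
     cfun.dim (\<Sum>i<s. tangent_cone m n (p i)) =
       min (s * (m + n + 1)) ((m + 1) * ((n + 2) choose 2)))"

definition r_bound :: "nat \<Rightarrow> nat \<Rightarrow> real" where
  "r_bound m n = (if even m \<and> odd n then real m ^ 3 - 2 * real m
     else (real m - 2) * (real m + 1)\<^sup>2 / 2)"

lemma tens_square_apply: "tens u (sym_square v) (i, j, k) = u i * (v j * v k)"
  by (simp add: tens_def sym_prod_def)

lemma tens_square_proportional:
  assumes "u \<noteq> 0" "v \<noteq> 0"
    and eq: "proj_point (tens u (sym_square v)) = proj_point (tens u' (sym_square v'))"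
  shows "\<exists>a b. a \<noteq> 0 \<and> b \<noteq> 0 \<and> u' = cscale a u \<and> v' = cscale b v"
proof -
  let ?t = "tens u (sym_square v)" and ?t' = "tens u' (sym_square v')"
  obtain i0 j0 where nz: "u i0 \<noteq> 0" "v j0 \<noteq> 0"
    using assms(1,2) by (auto simp: fun_eq_iff)
  have "?t' \<in> cfun.span {?t}" "?t \<in> cfun.span {?t'}"
    using eq cfun.span_base[of ?t "{?t}"] cfun.span_base[of ?t' "{?t'}"]
    by (simp_all add: proj_point_def)
  then obtain c d where c: "?t' = cscale c ?t" and d: "?t = cscale d ?t'"
    unfolding cfun.span_singleton by blast
  have c': "u' i * (v' j * v' k) = c * (u i * (v j * v k))" for i j k
    using fun_cong[OF c, of "(i, j, k)"] by (simp add: tens_square_apply cscale_def)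
  have d': "u i * (v j * v k) = d * (u' i * (v' j * v' k))" for i j k
    using fun_cong[OF d, of "(i, j, k)"] by (simp add: tens_square_apply cscale_def)
  have "u i0 * (v j0 * v j0) \<noteq> 0" using nz by simp
  then have "u' i0 * (v' j0 * v' j0) \<noteq> 0" using d'[of i0 j0 j0] by (metis mult_zero_right)
  then have nz': "u' i0 \<noteq> 0" "v' j0 \<noteq> 0" and "c \<noteq> 0"
    using c'[of i0 j0 j0] by (auto simp del: mult_eq_0_iff)
  define a where "a = c * (v j0 * v j0) / (v' j0 * v' j0)"
  define b where "b = c * (u i0 * v j0) / (u' i0 * v' j0)"
  have "u' i = a * u i" for i
    using c'[of i j0 j0] nz' by (simp add: a_def divide_simps mult_ac)
  moreover have "v' k = b * v k" for k
    using c'[of i0 j0 k] nz' by (simp add: b_def divide_simps mult_ac)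
  moreover have "a \<noteq> 0" "b \<noteq> 0" using \<open>c \<noteq> 0\<close> nz nz' by (auto simp: a_def b_def)
  ultimately show ?thesis
    by (intro exI[of _ a] exI[of _ b]) (simp add: cscale_def fun_eq_iff)
qed

lemma cscale_image_cspace: "a \<noteq> 0 \<Longrightarrow> cscale a ` cspace d = cspace d"
proof (intro equalityI subsetI)
  fix x assume "a \<noteq> 0" "x \<in> cspace d"
  then have "x = cscale a (cscale (1 / a) x)" "cscale (1 / a) x \<in> cspace d"
    by (auto simp: cscale_def cspace_def)
  then show "x \<in> cscale a ` cspace d" by blast
qed (auto simp: cscale_def cspace_def)

lemma tangent_at_cscale:
  assumes "a \<noteq> 0" "b \<noteq> 0"
  shows "tangent_at m n (cscale a u) (cscale b v) = tangent_at m n u v"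
proof -
  have "(\<lambda>x. tens x (sym_square (cscale b v))) = (\<lambda>x. tens x (sym_square v)) \<circ> cscale (b * b)"
    by (auto simp: fun_eq_iff tens_def sym_prod_def cscale_def algebra_simps)
  moreover have "(\<lambda>w. tens (cscale a u) (sym_prod (cscale b v) w))
      = (\<lambda>w. tens u (sym_prod v w)) \<circ> cscale (a * b)"
    by (auto simp: fun_eq_iff tens_def sym_prod_def cscale_def field_simps)
  ultimately show ?thesis
    using assms unfolding tangent_at_def
    by (simp only: image_comp [symmetric] cscale_image_cspace mult_eq_0_iff simp_thms)
qed

lemma tangent_cone_eq:
  assumes u: "u \<in> cspace (m + 1) - {0}" and v: "v \<in> cspace (n + 1) - {0}"
  shows "tangent_cone m n (proj_point (tens u (sym_square v))) = tangent_at m n u v"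
proof -
  have "tangent_at m n u' v' = tangent_at m n u v"
    if "proj_point (tens u (sym_square v)) = proj_point (tens u' (sym_square v'))" for u' v'
    using tens_square_proportional[OF _ _ that] u v tangent_at_cscale by auto
  then show ?thesis using assms unfolding tangent_cone_def by blast
qed

end

theory Submission
  imports Defs "Jordan_Normal_Form.Determinant"
begin

text \<open>
  Put \<open>M = m + 1\<close>.  The hypothesis \<open>n > r(m,n)\<close> is what makes the excess
  \<open>(m+1)m(m-1) / (2(m+n+1))\<close> of \<open>(m+1)(n+2 choose 2) / (m+n+1)\<close> over \<open>(m+1)(n+2-m) / 2\<close> too small to
  matter, so that the number \<open>s\<close> of points satisfies \<open>2 s \<le> M (n + 2 - m)\<close>
  (\<open>max_points_bound\<close>).  In that range the tangent spaces at general points are linearly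
  independent.  Independence is an open condition, detected by a Gram determinant that is
  multihomogeneous in the points (\<open>T12_if_tangents_independent\<close>); hence it is enough to exhibit one
  configuration of \<open>\<lfloor>M (n + 2 - m) / 2\<rfloor>\<close> points with independent tangent spaces
  (\<open>independent_family_exists\<close>).

  The configuration is explicit and is built by enlarging \<open>W\<close> by two dimensions
  \<open>\<langle>f, g\<rangle>\<close> and adding \<open>M\<close> points at a time.  Choose a diagonalizable operator \<open>A\<close> on \<open>V\<close>
  with eigenbasis \<open>a\<^sub>j\<close> and distinct eigenvalues \<open>c\<^sub>j\<close>; the new points are
  \<open>a\<^sub>j \<otimes> (w\<^sub>j + f + c\<^sub>j g)\<^sup>2\<close>, where \<open>w\<^sub>0 = w\<^sub>1 = 0\<close> and \<open>w\<^sub>2, \<dots>, w\<^sub>m\<close> is a basis of a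
  fixed \<open>(m-1)\<close>-dimensional subspace \<open>W\<^sub>0\<close>.  In a linear relation among tangent vectors, take the
  component in \<open>V \<otimes> W g\<close> minus \<open>A\<close> applied to the component in \<open>V \<otimes> W f\<close>: the new points enter it
  only through vectors of \<open>V \<otimes> W\<^sub>0\<close>.  Therefore, if the vectors \<open>u\<^sub>l \<otimes> v\<^sub>l\<close> and
  \<open>A u\<^sub>l \<otimes> v\<^sub>l\<close> of the old points are jointly independent in \<open>V \<otimes> W/W\<^sub>0\<close>, then the old points
  are not involved in the components along \<open>f\<close> and \<open>g\<close>, and the relation splits into an old and a
  trivial new part (\<open>tangents_independent_step\<close>).

  The same condition must hold again in the next rounds, with other operators \<open>B\<close> in place of
  \<open>A\<close>.  For the points just added it says that the commutator of \<open>A\<close> and \<open>B\<close> is injective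
  (\<open>shift_independent_step\<close>).  An infinite family of diagonalizable operators with pairwise
  injective commutators is given by \<open>X + \<sigma> N\<close>, \<open>\<sigma> = 1, 2, 3, \<dots>\<close>, where \<open>X\<close> and \<open>N\<close> are the clock
  and shift matrices: the commutator of two of them is a nonzero multiple of \<open>X N - N X\<close>, and the
  eigenvalues are the roots of \<open>\<lambda>\<^sup>M = 1 + \<sigma>\<^sup>M\<close>.  The start is \<open>W = W\<^sub>0\<close> without points, or
  \<open>W = W\<^sub>0 \<oplus> \<langle>h\<rangle>\<close> with \<open>\<lfloor>M / 2\<rfloor>\<close> points, according to the parity of \<open>n + 2 - m\<close>.
\<close>

section \<open>Clock-and-shift operators\<close>

text \<open>
  The operator \<open>X + \<sigma> N\<close> on \<open>\<complex>\<^sup>M\<close>, where \<open>X\<close> is the diagonal matrix of the powers of a primitive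
  \<open>M\<close>-th root of unity and \<open>N\<close> is the cyclic shift of coordinates.  Vectors are functions on \<open>nat\<close>
  of which only the coordinates below \<open>M\<close> are meaningful.
\<close>

definition clock_shift :: "nat \<Rightarrow> complex \<Rightarrow> (nat \<Rightarrow> complex) \<Rightarrow> nat \<Rightarrow> complex" where
  "clock_shift M \<sigma> x i = cis (2 * pi / real M) ^ i * x i + \<sigma> * x (Suc i mod M)"

lemma prod_minus_roots_unity:
  fixes z :: complex
  assumes "M > 0"
  shows "(\<Prod>t<M. z - cis (2 * pi / real M) ^ t) = z ^ M - 1"
proof -
  let ?w = "\<lambda>t. cis (2 * pi / real M) ^ t"
  have w: "?w t = cis (2 * pi * real t / real M)" for t
    by (simp add: Complex.DeMoivre mult_ac)
  define p where "p = (\<Prod>t<M. [:- ?w t, 1:])"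
  define q where "q = p - (monom 1 M - 1)"
  have dp: "degree p = M"
    unfolding p_def by (subst degree_prod_eq_sum_degree) auto
  have mp: "coeff p M = 1"
    using lead_coeff_prod[of "\<lambda>t. [:- ?w t, 1:]" "{..<M}"] dp by (simp add: p_def)
  have "q = 0"
  proof (rule ccontr)
    assume q: "q \<noteq> 0"
    have "degree q \<le> M"
      unfolding q_def using dp
      by (intro degree_diff_le) (auto intro: degree_monom_le)
    moreover have "coeff q M = 0"
      using mp assms by (simp add: q_def coeff_monom)
    ultimately have dq: "degree q < M"
      using q by (metis assms le_neq_implies_less leading_coeff_0_iff)
    have "{z. z ^ M = 1} \<subseteq> {z. poly q z = 0}"
    proof
      fix z :: complex assume z: "z \<in> {z. z ^ M = 1}"
      then obtain t where t: "t < M" "z = ?w t"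
        using bij_betw_roots_unity[OF assms] unfolding bij_betw_def w by auto
      have "poly p z = 0"
        using t by (auto simp: p_def poly_prod)
      then show "z \<in> {z. poly q z = 0}"
        using z by (simp add: q_def poly_monom)
    qed
    then have "M \<le> card {z. poly q z = 0}"
      using card_mono[OF poly_roots_finite[OF q]] card_roots_unity_eq[OF assms] by metis
    also have "\<dots> \<le> degree q" using card_poly_roots_bound[OF q] .
    finally show False using dq by simp
  qed
  then have "poly p z = poly (monom 1 M - 1) z" by (simp add: q_def)
  then show ?thesis by (simp add: p_def poly_prod poly_monom)
qed

lemma clock_shift_cong:
  "\<forall>i<M. x i = y i \<Longrightarrow> i < M \<Longrightarrow> clock_shift M \<sigma> x i = clock_shift M \<sigma> y i"
  by (simp add: clock_shift_def)

lemma clock_shift_sum: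
  "clock_shift M \<sigma> (\<lambda>i. \<Sum>j\<in>J. b j * y j i) i = (\<Sum>j\<in>J. b j * clock_shift M \<sigma> (y j) i)"
  by (simp add: clock_shift_def sum_distrib_left distrib_left sum.distrib mult.left_commute)

lemma clock_shift_scale: "clock_shift M \<sigma> (\<lambda>i. b * y i) i = b * clock_shift M \<sigma> y i"
  by (simp add: clock_shift_def algebra_simps)

lemma inj_on_powers_of_root_unity:
  assumes "M > 0"
  shows "inj_on (\<lambda>t. cis (2 * pi / real M) ^ t) {..<M}"
  using bij_betw_roots_unity[OF assms] by (simp add: bij_betw_def Complex.DeMoivre mult_ac)

text \<open>
  Solving \<open>(X + \<sigma> N) x = \<lambda> x\<close> coordinate by coordinate from \<open>x\<^sub>0 = 1\<close> closes up cyclically precisely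
  if \<open>\<Prod>\<^sub>t (\<lambda> - \<omega>\<^sup>t) = \<sigma>\<^sup>M\<close>, that is, if \<open>\<lambda>\<^sup>M = 1 + \<sigma>\<^sup>M\<close>; this has \<open>M\<close> distinct solutions.
\<close>

lemma clock_shift_eigenvectors_exist:
  assumes "M > 0" and "s > 0"
  obtains c a where "inj_on c {..<M}" "\<And>j. a j 0 = 1"
    "\<And>j i. i < M \<Longrightarrow> clock_shift M (complex_of_real s) (a j) i = c j * a j i"
proof -
  let ?w = "cis (2 * pi / real M)"
  have winj: "inj_on (\<lambda>t. ?w ^ t) {..<M}"
    by (rule inj_on_powers_of_root_unity[OF \<open>M > 0\<close>])
  have w1: "?w ^ M = 1"
    using assms by (simp add: Complex.DeMoivre)
  define \<kappa> where "\<kappa> = complex_of_real (root M (1 + s ^ M))"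
  have \<kappa>: "\<kappa> ^ M = 1 + complex_of_real s ^ M"
    using assms by (simp add: \<kappa>_def flip: of_real_power)
  then have "\<kappa> ^ M \<noteq> 0"
    using assms by (metis add_nonneg_pos less_numeral_extra(3) of_real_1 of_real_add of_real_eq_0_iff of_real_power zero_less_one_class.zero_le_one zero_less_power)
  then have \<kappa>0: "\<kappa> \<noteq> 0" using assms by (metis power_0_left not_gr_zero)
  define c where "c = (\<lambda>j. \<kappa> * ?w ^ j)"
  define a where "a = (\<lambda>j i. (\<Prod>t<i. (c j - ?w ^ t) / complex_of_real s))"
  have "inj_on c {..<M}"
    using winj \<kappa>0 by (auto simp: inj_on_def c_def)
  moreover have "a j 0 = 1" for j by (simp add: a_def)
  moreover have "clock_shift M (complex_of_real s) (a j) i = c j * a j i" if "i < M" for i j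
  proof -
    have step: "complex_of_real s * a j (Suc i) = (c j - ?w ^ i) * a j i"
      using assms by (simp add: a_def)
    have "c j ^ M = \<kappa> ^ M"
      using w1 by (simp add: c_def power_mult_distrib power_mult [symmetric] mult.commute)
        (simp add: power_mult)
    then have "(\<Prod>t<M. c j - ?w ^ t) = complex_of_real s ^ M"
      using \<kappa> prod_minus_roots_unity[OF \<open>M > 0\<close>, of "c j"] by simp
    then have aM: "a j M = 1"
      using assms by (simp add: a_def prod_dividef)
    have "a j (Suc i mod M) = a j (Suc i)"
    proof (cases "Suc i = M")
      case True
      then show ?thesis using aM by (simp add: a_def)
    next
      case False
      then show ?thesis using that by simp
    qed
    then show ?thesis
      using step by (simp add: clock_shift_def algebra_simps)
  qed
  ultimately show ?thesis using that by blast
qed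

lemma clock_shift_eigenvectors_independent:
  assumes "finite J" "inj_on c J"
    "\<forall>j\<in>J. \<forall>i<M. clock_shift M \<sigma> (y j) i = c j * y j i"
    "\<forall>i<M. (\<Sum>j\<in>J. y j i) = 0"
  shows "\<forall>j\<in>J. \<forall>i<M. y j i = 0"
  using assms
proof (induction J arbitrary: y rule: finite_induct)
  case (insert k J)
  have eq: "(\<Sum>j\<in>J. (c j - c k) * y j i) = 0" if i: "i < M" for i
  proof -
    have "(\<Sum>j\<in>insert k J. c j * y j i) = (\<Sum>j\<in>insert k J. 1 * clock_shift M \<sigma> (y j) i)"
      using insert.prems(2) i by (intro sum.cong) auto
    also have "\<dots> = clock_shift M \<sigma> (\<lambda>i. \<Sum>j\<in>insert k J. 1 * y j i) i"
      by (simp only: clock_shift_sum)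
    also have "\<dots> = clock_shift M \<sigma> (\<lambda>_. 0) i"
      using insert.prems(3) i by (intro clock_shift_cong) simp_all
    also have "\<dots> = 0"
      by (simp add: clock_shift_def)
    finally have "(\<Sum>j\<in>insert k J. c j * y j i) = 0" .
    moreover have "(\<Sum>j\<in>insert k J. (c j - c k) * y j i)
        = (\<Sum>j\<in>insert k J. c j * y j i) - c k * (\<Sum>j\<in>insert k J. y j i)"
      by (simp only: sum_distrib_left sum_subtractf[symmetric] left_diff_distrib)
    ultimately have "(\<Sum>j\<in>insert k J. (c j - c k) * y j i) = 0"
      using insert.prems(3) i by simp
    then show ?thesis using insert.hyps by simp
  qed
  have "\<forall>j\<in>J. \<forall>i<M. (c j - c k) * y j i = 0"
  proof (rule insert.IH)
    show "inj_on c J" using insert.prems by simp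
    show "\<forall>i<M. (\<Sum>j\<in>J. (c j - c k) * y j i) = 0" using eq by blast
    show "\<forall>j\<in>J. \<forall>i<M. clock_shift M \<sigma> (\<lambda>i. (c j - c k) * y j i) i = c j * ((c j - c k) * y j i)"
      using insert.prems(2) by (simp add: clock_shift_scale)
  qed
  moreover have "c j \<noteq> c k" if "j \<in> J" for j
    using insert that by (auto simp: inj_on_def)
  ultimately have J: "\<forall>j\<in>J. \<forall>i<M. y j i = 0" by simp
  then have "\<forall>i<M. y k i = 0" using insert by simp
  then show ?case using J by simp
qed simp

text \<open>
  The rows of \<open>L\<close> are the functionals dual to the basis \<open>a\<^sub>0, \<dots>, a\<^bsub>M-1\<^esub>\<close> of \<open>\<complex>\<^sup>M\<close>.
\<close>

lemma dual_basis_exists: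
  fixes a :: "nat \<Rightarrow> nat \<Rightarrow> complex"
  assumes ind: "\<And>x. \<forall>i<M. (\<Sum>j<M. x j * a j i) = 0 \<Longrightarrow> \<forall>j<M. x j = 0"
  obtains L where
    "\<And>j k. j < M \<Longrightarrow> k < M \<Longrightarrow> (\<Sum>i<M. L k i * a j i) = (if j = k then 1 else 0)"
    "\<And>x i. i < M \<Longrightarrow> (\<Sum>k<M. a k i * (\<Sum>i<M. L k i * x i)) = x i"
proof -
  define P where "P = mat M M (\<lambda>(i, j). a j i)"
  have P: "P \<in> carrier_mat M M" by (simp add: P_def)
  have "det P \<noteq> 0"
  proof
    assume "det P = 0"
    then obtain v where v: "v \<in> carrier_vec M" "v \<noteq> 0\<^sub>v M" "P *\<^sub>v v = 0\<^sub>v M"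
      using det_0_iff_vec_prod_zero_field[OF P] by auto
    have "\<forall>i<M. (\<Sum>j<M. v $ j * a j i) = 0"
    proof (intro allI impI)
      fix i assume i: "i < M"
      have "(P *\<^sub>v v) $ i = (\<Sum>j<M. v $ j * a j i)"
        using i v(1) by (simp add: P_def scalar_prod_def mult.commute atLeast0LessThan)
      then show "(\<Sum>j<M. v $ j * a j i) = 0" using v i by simp
    qed
    then have "\<forall>j<M. v $ j = 0" by (rule ind)
    then show False using v by (auto intro!: eq_vecI)
  qed
  then have "P \<in> Units (ring_mat TYPE(complex) M ())"
    by (rule det_non_zero_imp_unit[OF P])
  then obtain Q where Q: "Q \<in> carrier_mat M M" "Q * P = 1\<^sub>m M" "P * Q = 1\<^sub>m M"
    by (auto simp: Units_def ring_mat_def)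
  define L where "L = (\<lambda>k i. Q $$ (k, i))"
  have LP: "(\<Sum>i<M. L k i * a j i) = (if j = k then 1 else 0)" if "j < M" "k < M" for j k
  proof -
    have "(Q * P) $$ (k, j) = (\<Sum>i<M. L k i * a j i)"
      using that Q(1) P by (simp add: P_def L_def scalar_prod_def atLeast0LessThan)
    then show ?thesis using Q that by auto
  qed
  have PL: "(\<Sum>k<M. a k i * L k i') = (if i = i' then 1 else 0)" if "i < M" "i' < M" for i i'
  proof -
    have "(P * Q) $$ (i, i') = (\<Sum>k<M. a k i * L k i')"
      using that Q(1) P by (simp add: P_def L_def scalar_prod_def atLeast0LessThan)
    then show ?thesis using Q that by auto
  qed
  have "(\<Sum>k<M. a k i * (\<Sum>i<M. L k i * x i)) = x i" if i: "i < M" for x :: "nat \<Rightarrow> complex" and i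
  proof -
    have "(\<Sum>k<M. a k i * (\<Sum>i<M. L k i * x i)) = (\<Sum>i'<M. (\<Sum>k<M. a k i * L k i') * x i')"
      by (simp add: sum_distrib_left sum_distrib_right mult.assoc) (rule sum.swap)
    also have "\<dots> = (\<Sum>i'<M. if i = i' then x i' else 0)"
      using PL i by (intro sum.cong) auto
    also have "\<dots> = x i" using i by simp
    finally show ?thesis .
  qed
  with LP show ?thesis using that by blast
qed

lemma clock_shift_diagonalizable:
  assumes "M > 0" and "s > 0"
  obtains c a L where "inj_on c {..<M}"
    "\<And>j i. i < M \<Longrightarrow> clock_shift M (complex_of_real s) (a j) i = c j * a j i"
    "\<And>j k. j < M \<Longrightarrow> k < M \<Longrightarrow> (\<Sum>i<M. L k i * a j i) = (if j = k then 1 else 0)"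
    "\<And>x i. i < M \<Longrightarrow> (\<Sum>k<M. a k i * (\<Sum>i<M. L k i * x i)) = x i"
    "\<And>x k. k < M \<Longrightarrow> (\<Sum>i<M. L k i * clock_shift M (complex_of_real s) x i)
        = c k * (\<Sum>i<M. L k i * x i)"
proof -
  let ?A = "clock_shift M (complex_of_real s)"
  obtain c a where c: "inj_on c {..<M}" and a0: "\<And>j. a j 0 = 1"
    and a: "\<And>j i. i < M \<Longrightarrow> ?A (a j) i = c j * a j i"
    using clock_shift_eigenvectors_exist[OF assms] by metis
  have ind: "\<forall>j<M. x j = 0" if "\<forall>i<M. (\<Sum>j<M. x j * a j i) = 0" for x
  proof -
    have "\<forall>j\<in>{..<M}. \<forall>i<M. x j * a j i = 0"
      using a that
      by (intro clock_shift_eigenvectors_independent[where c = c and \<sigma> = "complex_of_real s"])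
        (auto simp: c clock_shift_scale)
    then show ?thesis using a0 assms(1) by (metis lessThan_iff mult_cancel_left1 mult_eq_0_iff one_neq_zero)
  qed
  obtain L where L1: "\<And>j k. j < M \<Longrightarrow> k < M \<Longrightarrow> (\<Sum>i<M. L k i * a j i) = (if j = k then 1 else 0)"
    and L2: "\<And>x i. i < M \<Longrightarrow> (\<Sum>k<M. a k i * (\<Sum>i<M. L k i * x i)) = x i"
    by (rule dual_basis_exists[of M a, OF ind]) blast+
  have L3: "(\<Sum>i<M. L k i * ?A x i) = c k * (\<Sum>i<M. L k i * x i)" if k: "k < M" for x k
  proof -
    define lam where "lam = (\<lambda>k. \<Sum>i<M. L k i * x i)"
    have "(\<Sum>i<M. L k i * ?A x i) = (\<Sum>i<M. L k i * (\<Sum>j<M. lam j * (c j * a j i)))"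
    proof (intro sum.cong refl)
      fix i assume i: "i \<in> {..<M}"
      have "?A x i = ?A (\<lambda>i. \<Sum>j<M. lam j * a j i) i"
        using L2[where x = x] i by (intro clock_shift_cong) (simp_all add: lam_def mult.commute[of "sum _ _" "a _ _"])
      also have "\<dots> = (\<Sum>j<M. lam j * (c j * a j i))"
        using i a by (simp add: clock_shift_sum)
      finally show "L k i * ?A x i = L k i * (\<Sum>j<M. lam j * (c j * a j i))" by simp
    qed
    also have "\<dots> = (\<Sum>j<M. lam j * c j * (\<Sum>i<M. L k i * a j i))"
      by (simp add: sum_distrib_left mult_ac) (rule sum.swap)
    also have "\<dots> = (\<Sum>j<M. if j = k then lam j * c j else 0)"
      using L1 k by (intro sum.cong) auto
    also have "\<dots> = c k * lam k" using k by simp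
    finally show ?thesis by (simp add: lam_def)
  qed
  show ?thesis by (rule that[OF c a L1 L2 L3])
qed

text \<open>
  The commutator of \<open>X + \<sigma> N\<close> and \<open>X + \<tau> N\<close> is a nonzero multiple of \<open>X N - N X\<close>, which sends
  \<open>x\<close> to the vector with coordinates \<open>\<omega>\<^sup>i (1 - \<omega>) x\<^bsub>i+1\<^esub>\<close>, indices modulo \<open>M\<close>.
\<close>

lemma clock_shift_commutator_injective:
  assumes M: "M \<ge> 2" and "\<sigma> \<noteq> \<tau>"
    and comm: "\<forall>i<M. clock_shift M \<sigma> (clock_shift M \<tau> x) i = clock_shift M \<tau> (clock_shift M \<sigma> x) i"
    and j: "j < M"
  shows "x j = 0"
proof -
  define w where "w = cis (2 * pi / real M)"
  have cs: "clock_shift M \<rho> z i = w ^ i * z i + \<rho> * z (Suc i mod M)" for \<rho> z i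
    by (simp add: clock_shift_def w_def)
  have "w ^ M = 1" using M by (simp add: w_def Complex.DeMoivre)
  then have wmod: "w ^ (Suc i mod M) = w ^ Suc i" if "i < M" for i
    using that by (cases "Suc i = M") simp_all
  have "w \<noteq> 1"
    using inj_onD[OF inj_on_powers_of_root_unity[of M], of 0 1] M by (auto simp: w_def)
  obtain i where i: "i < M" "j = Suc i mod M"
  proof (cases j)
    case 0
    then show ?thesis using that[of "M - 1"] M by simp
  next
    case (Suc i)
    then show ?thesis using that[of i] j by simp
  qed
  have "(\<sigma> - \<tau>) * w ^ i * (w - 1) * x j
      = clock_shift M \<sigma> (clock_shift M \<tau> x) i - clock_shift M \<tau> (clock_shift M \<sigma> x) i"
    unfolding i(2) by (simp add: cs wmod i(1) algebra_simps)
  then show ?thesis using comm i(1) \<open>\<sigma> \<noteq> \<tau>\<close> \<open>w \<noteq> 1\<close> by (simp add: w_def)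
qed

section \<open>Independence of tangent spaces\<close>

text \<open>
  For \<open>l < s\<close> let \<open>u\<^sub>l\<close> be a vector of \<open>\<complex>\<^sup>M\<close> and \<open>v\<^sub>l\<close> a vector of \<open>\<complex>\<^sup>d\<close>.  The definition says
  that a relation \<open>\<Sum>\<^sub>l (\<alpha>\<^sub>l \<otimes> v\<^sub>l\<^sup>2 + 2 u\<^sub>l \<otimes> v\<^sub>l \<beta>\<^sub>l) = 0\<close> between tangent vectors at the points
  \<open>u\<^sub>l \<otimes> v\<^sub>l\<^sup>2\<close> holds only for the trivial reason that
  \<open>- 2 t u\<^sub>l \<otimes> v\<^sub>l\<^sup>2 + 2 u\<^sub>l \<otimes> v\<^sub>l (t v\<^sub>l) = 0\<close>.  For nonzero \<open>u\<^sub>l\<close> and \<open>v\<^sub>l\<close> this means that the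
  sum of the tangent spaces, each of dimension \<open>M + d - 1\<close>, is direct.  The factor 2 avoids the denominator of \<open>sym_prod\<close>.
\<close>

definition tangents_independent ::
    "nat \<Rightarrow> nat \<Rightarrow> nat \<Rightarrow> (nat \<Rightarrow> nat \<Rightarrow> complex) \<Rightarrow> (nat \<Rightarrow> nat \<Rightarrow> complex) \<Rightarrow> bool" where
  "tangents_independent M d s u v \<longleftrightarrow> (\<forall>\<alpha> \<beta>.
     (\<forall>i<M. \<forall>j<d. \<forall>k<d. (\<Sum>l<s. \<alpha> l i * (v l j * v l k) + u l i * (v l j * \<beta> l k + \<beta> l j * v l k)) = 0)
     \<longrightarrow> (\<forall>l<s. \<exists>t. (\<forall>i<M. \<alpha> l i = - 2 * t * u l i) \<and> (\<forall>k<d. \<beta> l k = t * v l k)))"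

text \<open>
  With \<open>A = clock_shift M \<sigma>\<close>, the \<open>2 s\<close> vectors \<open>u\<^sub>l \<otimes> v\<^sub>l\<close> and \<open>A u\<^sub>l \<otimes> v\<^sub>l\<close> are linearly
  independent in \<open>\<complex>\<^sup>M \<otimes> (\<complex>\<^sup>d / W\<^sub>0)\<close>, where \<open>W\<^sub>0\<close> is spanned by the first \<open>M - 2\<close> basis vectors of
  \<open>\<complex>\<^sup>d\<close>.
\<close>

definition shift_independent ::
    "nat \<Rightarrow> nat \<Rightarrow> complex \<Rightarrow> nat \<Rightarrow> (nat \<Rightarrow> nat \<Rightarrow> complex) \<Rightarrow> (nat \<Rightarrow> nat \<Rightarrow> complex) \<Rightarrow> bool" where
  "shift_independent M d \<sigma> s u v \<longleftrightarrow> (\<forall>p q.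
     (\<forall>i<M. \<forall>k<d. M - 2 \<le> k \<longrightarrow>
        (\<Sum>l<s. v l k * (q l * u l i - p l * clock_shift M \<sigma> (u l) i)) = 0)
     \<longrightarrow> (\<forall>l<s. p l = 0 \<and> q l = 0))"

lemma tangents_independentD:
  assumes "tangents_independent M d s u v" and "l < s"
    and "\<And>i j k. i < M \<Longrightarrow> j < d \<Longrightarrow> k < d \<Longrightarrow>
      (\<Sum>l<s. \<alpha> l i * (v l j * v l k) + u l i * (v l j * \<beta> l k + \<beta> l j * v l k)) = 0"
  obtains t where "\<And>i. i < M \<Longrightarrow> \<alpha> l i = - 2 * t * u l i" "\<And>k. k < d \<Longrightarrow> \<beta> l k = t * v l k"
proof -
  have "\<exists>t. (\<forall>i<M. \<alpha> l i = - 2 * t * u l i) \<and> (\<forall>k<d. \<beta> l k = t * v l k)"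
    using assms(3) by (intro assms(1)[unfolded tangents_independent_def, rule_format, OF _ assms(2)])
  then show ?thesis using that by auto
qed

lemma tangents_independent_restrict:
  assumes T: "tangents_independent M d s' u v" and "s \<le> s'"
    and u: "\<And>l i. l < s \<Longrightarrow> i < M \<Longrightarrow> u' l i = u l i"
  shows "tangents_independent M d s u' v"
  unfolding tangents_independent_def
proof (intro allI impI)
  fix \<alpha> \<beta> :: "nat \<Rightarrow> nat \<Rightarrow> complex" and l
  assume rel: "\<forall>i<M. \<forall>j<d. \<forall>k<d.
    (\<Sum>l<s. \<alpha> l i * (v l j * v l k) + u' l i * (v l j * \<beta> l k + \<beta> l j * v l k)) = 0"
  assume l: "l < s"
  define \<alpha>' where "\<alpha>' = (\<lambda>l i. if l < s then \<alpha> l i else 0)"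
  define \<beta>' where "\<beta>' = (\<lambda>l k. if l < s then \<beta> l k else 0)"
  have rel': "(\<Sum>l<s'. \<alpha>' l i * (v l j * v l k) + u l i * (v l j * \<beta>' l k + \<beta>' l j * v l k)) = 0"
    if "i < M" "j < d" "k < d" for i j k
  proof -
    have "(\<Sum>l<s'. \<alpha>' l i * (v l j * v l k) + u l i * (v l j * \<beta>' l k + \<beta>' l j * v l k))
      = (\<Sum>l<s. \<alpha>' l i * (v l j * v l k) + u l i * (v l j * \<beta>' l k + \<beta>' l j * v l k))"
      using \<open>s \<le> s'\<close> by (intro sum.mono_neutral_right) (auto simp: \<alpha>'_def \<beta>'_def)
    also have "\<dots> = (\<Sum>l<s. \<alpha> l i * (v l j * v l k) + u' l i * (v l j * \<beta> l k + \<beta> l j * v l k))"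
      using u that by (intro sum.cong) (auto simp: \<alpha>'_def \<beta>'_def)
    finally show ?thesis using rel that by simp
  qed
  have "l < s'" using l \<open>s \<le> s'\<close> by simp
  then obtain t where "\<And>i. i < M \<Longrightarrow> \<alpha>' l i = - 2 * t * u l i" "\<And>k. k < d \<Longrightarrow> \<beta>' l k = t * v l k"
    using tangents_independentD[OF T _ rel'] by metis
  then show "\<exists>t. (\<forall>i<M. \<alpha> l i = - 2 * t * u' l i) \<and> (\<forall>k<d. \<beta> l k = t * v l k)"
    using l u by (intro exI[of _ t]) (simp add: \<alpha>'_def \<beta>'_def)
qed

lemma shift_independentD:
  assumes "shift_independent M d \<sigma> s u v"
    and "\<And>i k. i < M \<Longrightarrow> k < d \<Longrightarrow> M - 2 \<le> k \<Longrightarrow>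
      (\<Sum>l<s. v l k * (q l * u l i - p l * clock_shift M \<sigma> (u l) i)) = 0"
    and "l < s"
  shows "p l = 0" "q l = 0"
proof -
  have "p l = 0 \<and> q l = 0"
    using assms(2) by (intro assms(1)[unfolded shift_independent_def, rule_format, OF _ assms(3)])
  then show "p l = 0" "q l = 0" by simp_all
qed

section \<open>Adding two dimensions and a block of points\<close>

definition append_family :: "nat \<Rightarrow> (nat \<Rightarrow> 'a) \<Rightarrow> (nat \<Rightarrow> 'a) \<Rightarrow> nat \<Rightarrow> 'a" where
  "append_family s f g l = (if l < s then f l else g (l - s))"

text \<open>
  The vector \<open>w\<^sub>j + f + c\<^sub>j g\<close>, where \<open>f\<close> and \<open>g\<close> are the basis vectors number \<open>d\<close> and \<open>d + 1\<close>, and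
  \<open>w\<^sub>j\<close> is the basis vector number \<open>j - 2\<close> for \<open>j \<ge> 2\<close> and zero for \<open>j < 2\<close>.
\<close>

definition new_point :: "nat \<Rightarrow> (nat \<Rightarrow> complex) \<Rightarrow> nat \<Rightarrow> nat \<Rightarrow> complex" where
  "new_point d c j k = (if k = d then 1 else if k = d + 1 then c j else if k + 2 = j then 1 else 0)"

lemma sum_lessThan_add:
  fixes f :: "nat \<Rightarrow> 'a::comm_monoid_add"
  shows "(\<Sum>l<s + M. f l) = (\<Sum>l<s. f l) + (\<Sum>j<M. f (s + j))"
  by (induction M) (simp_all add: add.assoc)

text \<open>
  The proof works in the eigenbasis of \<open>A\<close>, with the \<open>\<kappa>\<close>-th eigencoordinate \<open>lam \<kappa>\<close>.  The
  quantities \<open>\<delta> \<kappa> n\<close> are the coordinates of \<open>(c\<^sub>n - A) \<alpha>\<^sub>n + (q\<^sub>n - c\<^sub>n p\<^sub>n) a\<^sub>n\<close>, where \<open>p\<^sub>n\<close> and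
  \<open>q\<^sub>n\<close> are the \<open>f\<close>- and \<open>g\<close>-coordinates of \<open>\<beta>\<^sub>n\<close> at the new points.  Once all of them vanish,
  \<open>\<alpha>\<^sub>n\<close> is a multiple of \<open>a\<^sub>n\<close>, since the eigenvalues are distinct.
\<close>

lemma tangents_independent_step:
  assumes M: "M \<ge> 2" and d: "M - 2 \<le> d"
    and c: "inj_on c {..<M}"
    and La: "\<And>j k. j < M \<Longrightarrow> k < M \<Longrightarrow> (\<Sum>i<M. L k i * a j i) = (if j = k then 1 else 0)"
    and aL: "\<And>x i. i < M \<Longrightarrow> (\<Sum>k<M. a k i * (\<Sum>i<M. L k i * x i)) = x i"
    and LA: "\<And>x k. k < M \<Longrightarrow> (\<Sum>i<M. L k i * clock_shift M \<sigma> x i) = c k * (\<Sum>i<M. L k i * x i)"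
    and T: "tangents_independent M d s u v"
    and v: "\<And>l k. l < s \<Longrightarrow> k \<ge> d \<Longrightarrow> v l k = 0"
    and D: "shift_independent M d \<sigma> s u v"
  shows "tangents_independent M (d + 2) (s + M) (append_family s u a)
           (append_family s v (new_point d c))"
  unfolding tangents_independent_def
proof (intro allI impI)
  fix \<alpha> \<beta> :: "nat \<Rightarrow> nat \<Rightarrow> complex" and l0
  let ?u = "append_family s u a" and ?v = "append_family s v (new_point d c)"
  assume rel: "\<forall>i<M. \<forall>j<d + 2. \<forall>k<d + 2. (\<Sum>l<s + M. \<alpha> l i * (?v l j * ?v l k)
      + ?u l i * (?v l j * \<beta> l k + \<beta> l j * ?v l k)) = 0"
  define \<alpha>' where "\<alpha>' = (\<lambda>j. \<alpha> (s + j))"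
  define \<beta>' where "\<beta>' = (\<lambda>j. \<beta> (s + j))"
  define y where "y = new_point d c"
  define w :: "nat \<Rightarrow> nat \<Rightarrow> complex" where "w = (\<lambda>j k. if k + 2 = j then 1 else 0)"
  define lam where "lam = (\<lambda>\<kappa> x. \<Sum>i<M. L \<kappa> i * x i)"
  have y: "y j k = w j k" if "k < d" for j k
    using that by (simp add: y_def w_def new_point_def)
  have yf: "y j d = 1" and yg: "y j (Suc d) = c j" for j
    by (simp_all add: y_def new_point_def)
  have split: "(\<Sum>l<s. \<alpha> l i * (v l j * v l k) + u l i * (v l j * \<beta> l k + \<beta> l j * v l k))
     + (\<Sum>n<M. \<alpha>' n i * (y n j * y n k) + a n i * (y n j * \<beta>' n k + \<beta>' n j * y n k)) = 0"
    if "i < M" "j < d + 2" "k < d + 2" for i j k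
  proof -
    have "(\<Sum>l<s + M. \<alpha> l i * (?v l j * ?v l k)
      + ?u l i * (?v l j * \<beta> l k + \<beta> l j * ?v l k)) = 0"
      using rel that by blast
    then show ?thesis
      unfolding sum_lessThan_add by (simp add: append_family_def \<alpha>'_def \<beta>'_def y_def)
  qed
  have row: "(\<Sum>l<s. lam \<kappa> (\<alpha> l) * (v l j * v l k) + lam \<kappa> (u l) * (v l j * \<beta> l k + \<beta> l j * v l k))
     + (\<Sum>n<M. lam \<kappa> (\<alpha>' n) * (y n j * y n k)) + (y \<kappa> j * \<beta>' \<kappa> k + \<beta>' \<kappa> j * y \<kappa> k) = 0"
    if \<kappa>: "\<kappa> < M" and jk: "j < d + 2" "k < d + 2" for \<kappa> j k
  proof -
    have "0 = (\<Sum>i<M. L \<kappa> i * ((\<Sum>l<s. \<alpha> l i * (v l j * v l k) + u l i * (v l j * \<beta> l k + \<beta> l j * v l k))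
     + (\<Sum>n<M. \<alpha>' n i * (y n j * y n k) + a n i * (y n j * \<beta>' n k + \<beta>' n j * y n k))))"
      using split jk by simp
    also have "\<dots> = (\<Sum>i<M. \<Sum>l<s. L \<kappa> i * (\<alpha> l i * (v l j * v l k) + u l i * (v l j * \<beta> l k + \<beta> l j * v l k)))
     + (\<Sum>i<M. \<Sum>n<M. L \<kappa> i * (\<alpha>' n i * (y n j * y n k) + a n i * (y n j * \<beta>' n k + \<beta>' n j * y n k)))"
      unfolding sum.distrib[symmetric] sum_distrib_left[symmetric] distrib_left[symmetric] ..
    also have "(\<Sum>i<M. \<Sum>l<s. L \<kappa> i * (\<alpha> l i * (v l j * v l k) + u l i * (v l j * \<beta> l k + \<beta> l j * v l k)))
      = (\<Sum>l<s. lam \<kappa> (\<alpha> l) * (v l j * v l k) + lam \<kappa> (u l) * (v l j * \<beta> l k + \<beta> l j * v l k))"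
      unfolding lam_def sum_distrib_right sum.distrib[symmetric]
      by (subst sum.swap) (simp only: distrib_left mult.assoc)
    also have "(\<Sum>i<M. \<Sum>n<M. L \<kappa> i * (\<alpha>' n i * (y n j * y n k) + a n i * (y n j * \<beta>' n k + \<beta>' n j * y n k)))
      = (\<Sum>n<M. lam \<kappa> (\<alpha>' n) * (y n j * y n k) + lam \<kappa> (a n) * (y n j * \<beta>' n k + \<beta>' n j * y n k))"
      unfolding lam_def sum_distrib_right sum.distrib[symmetric]
      by (subst sum.swap) (simp only: distrib_left mult.assoc)
    also have "\<dots> = (\<Sum>n<M. lam \<kappa> (\<alpha>' n) * (y n j * y n k))
        + (\<Sum>n<M. if n = \<kappa> then y n j * \<beta>' n k + \<beta>' n j * y n k else 0)"
      unfolding sum.distrib using La \<kappa> by (intro arg_cong2[of _ _ _ _ "(+)"] sum.cong) (auto simp: lam_def)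
    finally show ?thesis using \<kappa> by (simp add: add.assoc)
  qed
  define p where "p = (\<lambda>n. \<beta>' n d)"
  define q where "q = (\<lambda>n. \<beta>' n (Suc d))"
  define \<delta> where "\<delta> = (\<lambda>\<kappa> n. (c n - c \<kappa>) * lam \<kappa> (\<alpha>' n) + (if n = \<kappa> then q n - c n * p n else 0))"
  \<comment> \<open>The components of the relation along \<open>f\<^sup>2\<close>, \<open>f g\<close>, \<open>g\<^sup>2\<close>, and along \<open>e\<^sub>k f\<close> and \<open>e\<^sub>k g\<close>
      for the basis vectors \<open>e\<^sub>k\<close> of the old space.\<close>
  have FF: "(\<Sum>n<M. lam \<kappa> (\<alpha>' n)) + 2 * p \<kappa> = 0" if "\<kappa> < M" for \<kappa>
    using row[OF that, of d d] by (simp add: v yf p_def)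
  have FG: "(\<Sum>n<M. c n * lam \<kappa> (\<alpha>' n)) + (q \<kappa> + c \<kappa> * p \<kappa>) = 0" if "\<kappa> < M" for \<kappa>
    using row[OF that, of d "Suc d"] by (simp add: v yf yg p_def q_def mult.commute)
  have GG: "(\<Sum>n<M. c n * (c n * lam \<kappa> (\<alpha>' n))) + 2 * c \<kappa> * q \<kappa> = 0" if "\<kappa> < M" for \<kappa>
    using row[OF that, of "Suc d" "Suc d"] by (simp add: v yg q_def mult_ac)
  have KF: "(\<Sum>l<s. v l k * (lam \<kappa> (u l) * \<beta> l d)) + (\<Sum>n<M. w n k * lam \<kappa> (\<alpha>' n))
      + (w \<kappa> k * p \<kappa> + \<beta>' \<kappa> k) = 0" if "\<kappa> < M" "k < d" for \<kappa> k
    using row[OF that(1), of k d] that(2) by (simp add: v yf y p_def mult_ac)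
  have KG: "(\<Sum>l<s. v l k * (lam \<kappa> (u l) * \<beta> l (Suc d))) + (\<Sum>n<M. w n k * (c n * lam \<kappa> (\<alpha>' n)))
      + (w \<kappa> k * q \<kappa> + c \<kappa> * \<beta>' \<kappa> k) = 0" if "\<kappa> < M" "k < d" for \<kappa> k
    using row[OF that(1), of k "Suc d"] that(2) by (simp add: v yg y q_def mult_ac)
  have delta_sum: "(\<Sum>n<M. f n * \<delta> \<kappa> n) = (\<Sum>n<M. f n * (c n * lam \<kappa> (\<alpha>' n)))
      - c \<kappa> * (\<Sum>n<M. f n * lam \<kappa> (\<alpha>' n)) + f \<kappa> * (q \<kappa> - c \<kappa> * p \<kappa>)" if "\<kappa> < M" for f \<kappa>
  proof -
    have "(\<Sum>n<M. f n * \<delta> \<kappa> n) = (\<Sum>n<M. (f n * (c n * lam \<kappa> (\<alpha>' n)) - c \<kappa> * (f n * lam \<kappa> (\<alpha>' n)))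
        + (if n = \<kappa> then f n * (q n - c n * p n) else 0))"
      by (intro sum.cong) (auto simp: \<delta>_def algebra_simps)
    also have "\<dots> = (\<Sum>n<M. f n * (c n * lam \<kappa> (\<alpha>' n)) - c \<kappa> * (f n * lam \<kappa> (\<alpha>' n)))
        + f \<kappa> * (q \<kappa> - c \<kappa> * p \<kappa>)"
      unfolding sum.distrib using that by simp
    finally show ?thesis by (simp add: sum_subtractf sum_distrib_left)
  qed
  \<comment> \<open>The component along \<open>e\<^sub>k g\<close> minus \<open>A\<close> applied to the one along \<open>e\<^sub>k f\<close>; the old
      coordinates \<open>\<beta>' \<kappa> k\<close> of the new directions cancel.\<close>
  have K: "(\<Sum>l<s. v l k * (lam \<kappa> (u l) * (\<beta> l (Suc d) - c \<kappa> * \<beta> l d))) + (\<Sum>n<M. w n k * \<delta> \<kappa> n) = 0"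
    if "\<kappa> < M" "k < d" for \<kappa> k
  proof -
    have X: "(\<Sum>l<s. v l k * (lam \<kappa> (u l) * (\<beta> l (Suc d) - c \<kappa> * \<beta> l d)))
      = (\<Sum>l<s. v l k * (lam \<kappa> (u l) * \<beta> l (Suc d))) - c \<kappa> * (\<Sum>l<s. v l k * (lam \<kappa> (u l) * \<beta> l d))"
      unfolding sum_distrib_left sum_subtractf[symmetric] by (intro sum.cong) (auto simp: algebra_simps)
    have "X + S = 0" if "X = Y1 - c \<kappa> * Y0" "Y0 + W0 + (w \<kappa> k * p \<kappa> + \<beta>' \<kappa> k) = 0"
      "Y1 + W1 + (w \<kappa> k * q \<kappa> + c \<kappa> * \<beta>' \<kappa> k) = 0"
      "S = W1 - c \<kappa> * W0 + w \<kappa> k * (q \<kappa> - c \<kappa> * p \<kappa>)" for X S Y0 Y1 W0 W1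
    proof -
      have "X + S = (Y1 + W1 + (w \<kappa> k * q \<kappa> + c \<kappa> * \<beta>' \<kappa> k))
          - c \<kappa> * (Y0 + W0 + (w \<kappa> k * p \<kappa> + \<beta>' \<kappa> k))"
        unfolding that(1,4) by (simp add: algebra_simps)
      then show ?thesis unfolding that(2,3) by simp
    qed
    from this[OF X KF[OF that] KG[OF that] delta_sum[OF that(1)]] show ?thesis .
  qed
  \<comment> \<open>Modulo the span of the \<open>w\<^sub>n\<close> only the old points remain in \<open>K\<close>.\<close>
  have old0: "\<forall>l<s. \<beta> l d = 0 \<and> \<beta> l (Suc d) = 0"
  proof -
    have "(\<Sum>l<s. v l k * (\<beta> l (Suc d) * u l i - \<beta> l d * clock_shift M \<sigma> (u l) i)) = 0"
      if i: "i < M" and k: "k < d" "M - 2 \<le> k" for i k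
    proof -
      define z where "z = (\<lambda>i. \<Sum>l<s. v l k * (\<beta> l (Suc d) * u l i - \<beta> l d * clock_shift M \<sigma> (u l) i))"
      have "lam \<kappa> z = 0" if \<kappa>: "\<kappa> < M" for \<kappa>
      proof -
        have "lam \<kappa> z = (\<Sum>l<s. \<Sum>i<M. L \<kappa> i * (v l k * (\<beta> l (Suc d) * u l i - \<beta> l d * clock_shift M \<sigma> (u l) i)))"
          unfolding lam_def z_def sum_distrib_left by (rule sum.swap)
        also have "\<dots> = (\<Sum>l<s. v l k * (\<beta> l (Suc d) * (\<Sum>i<M. L \<kappa> i * u l i)
            - \<beta> l d * (\<Sum>i<M. L \<kappa> i * clock_shift M \<sigma> (u l) i)))"
          unfolding sum_distrib_left right_diff_distrib sum_subtractf[symmetric]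
          by (intro sum.cong refl) (simp add: mult_ac)
        also have "\<dots> = (\<Sum>l<s. v l k * (lam \<kappa> (u l) * (\<beta> l (Suc d) - c \<kappa> * \<beta> l d)))"
          using LA \<kappa> by (intro sum.cong refl) (simp add: lam_def algebra_simps)
        also have "\<dots> = 0"
        proof -
          have "(\<Sum>n<M. w n k * \<delta> \<kappa> n) = 0"
            using k(2) by (intro sum.neutral) (auto simp: w_def)
          then show ?thesis using K[OF \<kappa> k(1)] by simp
        qed
        finally show ?thesis .
      qed
      then have "z i = 0" using aL[OF i, of z] by (simp add: lam_def)
      then show ?thesis by (simp add: z_def)
    qed
    from shift_independentD[OF D this] show ?thesis by blast
  qed
  have \<delta>0: "\<delta> \<kappa> n = 0" if \<kappa>: "\<kappa> < M" and n: "n < M" for \<kappa> n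
  proof -
    \<comment> \<open>For \<open>n \<ge> 2\<close> read off the coordinate \<open>n - 2\<close>, where \<open>w\<^sub>n\<close> alone is nonzero.\<close>
    have ge2: "\<delta> \<kappa> n = 0" if n: "2 \<le> n" "n < M" for n
    proof -
      have "(\<Sum>n'<M. w n' (n - 2) * \<delta> \<kappa> n') = 0"
        using K[OF \<kappa>, of "n - 2"] old0 n d by simp
      moreover have "(\<Sum>n'<M. w n' (n - 2) * \<delta> \<kappa> n') = (\<Sum>n'<M. if n' = n then \<delta> \<kappa> n' else 0)"
        using n by (intro sum.cong) (auto simp: w_def)
      ultimately show ?thesis using n by simp
    qed
    \<comment> \<open>The two remaining values are determined by \<open>\<Sum>\<^sub>n \<delta> \<kappa> n = 0\<close> and \<open>\<Sum>\<^sub>n c\<^sub>n \<delta> \<kappa> n = 0\<close>,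
        since \<open>c\<^sub>0 \<noteq> c\<^sub>1\<close>.\<close>
    have two: "(\<Sum>n<M. f n * \<delta> \<kappa> n) = f 0 * \<delta> \<kappa> 0 + f 1 * \<delta> \<kappa> 1" for f
    proof -
      have "(\<Sum>n<M. f n * \<delta> \<kappa> n) = (\<Sum>n\<in>{0, 1}. f n * \<delta> \<kappa> n)"
        using M ge2 by (intro sum.mono_neutral_right) auto
      then show ?thesis by simp
    qed
    have ff: "(\<Sum>n<M. lam \<kappa> (\<alpha>' n)) = - (2 * p \<kappa>)"
      using FF[OF \<kappa>] by (simp only: eq_neg_iff_add_eq_0)
    have fg: "(\<Sum>n<M. c n * lam \<kappa> (\<alpha>' n)) = - (q \<kappa> + c \<kappa> * p \<kappa>)"
      using FG[OF \<kappa>] by (simp only: eq_neg_iff_add_eq_0)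
    have gg: "(\<Sum>n<M. c n * (c n * lam \<kappa> (\<alpha>' n))) = - (2 * c \<kappa> * q \<kappa>)"
      using GG[OF \<kappa>] by (simp only: eq_neg_iff_add_eq_0)
    have "(\<Sum>n<M. 1 * \<delta> \<kappa> n) = 0"
      using delta_sum[OF \<kappa>, of "\<lambda>_. 1"] by (simp add: ff fg algebra_simps)
    then have 1: "\<delta> \<kappa> 0 + \<delta> \<kappa> 1 = 0" using two[of "\<lambda>_. 1"] by simp
    have "(\<Sum>n<M. c n * \<delta> \<kappa> n) = 0"
      unfolding delta_sum[OF \<kappa>] fg gg by (simp add: algebra_simps)
    then have "c 0 * \<delta> \<kappa> 0 + c 1 * \<delta> \<kappa> 1 = 0" using two[of c] by simp
    moreover have "\<delta> \<kappa> 1 = - \<delta> \<kappa> 0" using 1 by (simp add: eq_neg_iff_add_eq_0 add.commute)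
    ultimately have "(c 0 - c 1) * \<delta> \<kappa> 0 = 0" by (simp add: algebra_simps)
    moreover have "c 0 \<noteq> c 1" using inj_onD[OF c, of 0 1] M by auto
    ultimately have "\<delta> \<kappa> 0 = 0" by simp
    with 1 have "\<delta> \<kappa> 1 = 0" by simp
    have "n = 0 \<or> n = 1 \<or> 2 \<le> n" by auto
    then show ?thesis using \<open>\<delta> \<kappa> 0 = 0\<close> \<open>\<delta> \<kappa> 1 = 0\<close> ge2 n by auto
  qed
  have off: "lam \<kappa> (\<alpha>' n) = 0" if "\<kappa> < M" "n < M" "n \<noteq> \<kappa>" for \<kappa> n
    using \<delta>0[OF that(1,2)] that c by (auto simp: \<delta>_def inj_on_def)
  have qp: "q \<kappa> = c \<kappa> * p \<kappa>" if "\<kappa> < M" for \<kappa>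
    using \<delta>0[OF that that] by (simp add: \<delta>_def)
  have pick: "(\<Sum>n<M. f n * lam \<kappa> (\<alpha>' n)) = f \<kappa> * lam \<kappa> (\<alpha>' \<kappa>)" if "\<kappa> < M" for f \<kappa>
  proof -
    have "(\<Sum>n<M. f n * lam \<kappa> (\<alpha>' n)) = (\<Sum>n<M. if n = \<kappa> then f n * lam \<kappa> (\<alpha>' n) else 0)"
      using off that by (intro sum.cong) auto
    then show ?thesis using that by simp
  qed
  have diag: "lam \<kappa> (\<alpha>' \<kappa>) = - 2 * p \<kappa>" if "\<kappa> < M" for \<kappa>
    using FF[OF that] pick[OF that, of "\<lambda>_. 1"] by (simp add: eq_neg_iff_add_eq_0)
  have \<alpha>': "\<alpha>' n i = - 2 * p n * a n i" if "n < M" "i < M" for n i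
  proof -
    have "\<alpha>' n i = (\<Sum>k<M. a k i * lam k (\<alpha>' n))"
      using aL[OF that(2), of "\<alpha>' n"] by (simp add: lam_def)
    also have "\<dots> = (\<Sum>k<M. if k = n then a k i * (- 2 * p n) else 0)"
      using off diag that by (intro sum.cong) auto
    also have "\<dots> = - 2 * p n * a n i" using that by simp
    finally show ?thesis .
  qed
  have \<beta>': "\<beta>' n k = p n * y n k" if n: "n < M" and k: "k < d + 2" for n k
  proof -
    consider "k = d" | "k = Suc d" | "k < d" using k by linarith
    then show ?thesis
    proof cases
      case 3
      have 0: "- 2 * p n * w n k + (w n k * p n + \<beta>' n k) = 0"
        using KF[OF n 3] old0 pick[OF n, of "\<lambda>n. w n k"] diag[OF n] by (simp add: mult_ac)
      have "\<beta>' n k - p n * w n k = - 2 * p n * w n k + (w n k * p n + \<beta>' n k)"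
        by (simp add: algebra_simps)
      also note 0
      finally show ?thesis unfolding y[OF 3] by simp
    qed (use qp[OF n] in \<open>simp_all add: yf yg p_def q_def\<close>)
  qed
  have old: "\<exists>t. (\<forall>i<M. \<alpha> l i = - 2 * t * u l i) \<and> (\<forall>k<d. \<beta> l k = t * v l k)" if l: "l < s" for l
  proof -
    have "(\<Sum>l<s. \<alpha> l i * (v l j * v l k) + u l i * (v l j * \<beta> l k + \<beta> l j * v l k)) = 0"
      if "i < M" "j < d" "k < d" for i j k
    proof -
      have "(\<Sum>n<M. \<alpha>' n i * (y n j * y n k) + a n i * (y n j * \<beta>' n k + \<beta>' n j * y n k)) = 0"
        using that by (intro sum.neutral) (simp add: \<alpha>' \<beta>' algebra_simps)
      then show ?thesis using split[of i j k] that by simp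
    qed
    from tangents_independentD[OF T l this] show ?thesis by metis
  qed
  assume l0: "l0 < s + M"
  show "\<exists>t. (\<forall>i<M. \<alpha> l0 i = - 2 * t * ?u l0 i) \<and> (\<forall>k<d + 2. \<beta> l0 k = t * ?v l0 k)"
  proof (cases "l0 < s")
    case True
    then obtain t where t: "\<forall>i<M. \<alpha> l0 i = - 2 * t * u l0 i" "\<forall>k<d. \<beta> l0 k = t * v l0 k"
      using old by blast
    have "\<beta> l0 k = t * v l0 k" if "k < d + 2" for k
    proof -
      consider "k = d" | "k = Suc d" | "k < d" using \<open>k < d + 2\<close> by linarith
      then show ?thesis using t old0 v True by cases auto
    qed
    then show ?thesis using t True by (auto simp: append_family_def)
  next
    case False
    then have "\<alpha> l0 = \<alpha>' (l0 - s)" "\<beta> l0 = \<beta>' (l0 - s)" "l0 - s < M"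
      using l0 by (auto simp: \<alpha>'_def \<beta>'_def)
    then show ?thesis
      using False \<alpha>' \<beta>' by (intro exI[of _ "p (l0 - s)"]) (simp add: append_family_def y_def)
  qed
qed

text \<open>
  The condition survives the addition of points built from a different operator \<open>B\<close>.  The new
  points contribute a relation \<open>\<Sum>\<^sub>n (q\<^sub>n a\<^sub>n - p\<^sub>n A a\<^sub>n) \<otimes> (f + c\<^sub>n g) = 0\<close>.  With
  \<open>z = \<Sum>\<^sub>n p\<^sub>n a\<^sub>n\<close> and \<open>B a\<^sub>n = c\<^sub>n a\<^sub>n\<close>, its \<open>f\<close>-part expresses \<open>\<Sum>\<^sub>n q\<^sub>n a\<^sub>n\<close> as \<open>A z\<close>, and then its
  \<open>g\<close>-part reads \<open>B A z = A B z\<close>.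
\<close>

lemma shift_independent_step:
  assumes M: "M \<ge> 2" and d: "M - 2 \<le> d" and "\<sigma> \<noteq> \<tau>"
    and a: "\<And>j i. i < M \<Longrightarrow> clock_shift M \<tau> (a j) i = c j * a j i"
    and ind: "\<And>x. \<forall>i<M. (\<Sum>j<M. x j * a j i) = 0 \<Longrightarrow> \<forall>j<M. x j = 0"
    and v: "\<And>l k. l < s \<Longrightarrow> k \<ge> d \<Longrightarrow> v l k = 0"
    and D: "shift_independent M d \<sigma> s u v"
  shows "shift_independent M (d + 2) \<sigma> (s + M) (append_family s u a)
           (append_family s v (new_point d c))"
  unfolding shift_independent_def
proof (intro allI impI)
  fix p q :: "nat \<Rightarrow> complex" and l0
  let ?u = "append_family s u a" and ?v = "append_family s v (new_point d c)"
  let ?A = "clock_shift M \<sigma>" and ?B = "clock_shift M \<tau>"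
  assume rel: "\<forall>i<M. \<forall>k<d + 2. M - 2 \<le> k \<longrightarrow>
        (\<Sum>l<s + M. ?v l k * (q l * ?u l i - p l * ?A (?u l) i)) = 0"
  define p' where "p' = (\<lambda>n. p (s + n))"
  define q' where "q' = (\<lambda>n. q (s + n))"
  have split: "(\<Sum>l<s. v l k * (q l * u l i - p l * ?A (u l) i))
      + (\<Sum>n<M. new_point d c n k * (q' n * a n i - p' n * ?A (a n) i)) = 0"
    if "i < M" "k < d + 2" "M - 2 \<le> k" for i k
  proof -
    have "(\<Sum>l<s + M. ?v l k * (q l * ?u l i - p l * ?A (?u l) i)) = 0"
      using rel that by blast
    then show ?thesis
      unfolding sum_lessThan_add by (simp add: append_family_def p'_def q'_def)
  qed
  have "(\<Sum>l<s. v l k * (q l * u l i - p l * ?A (u l) i)) = 0"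
    if "i < M" "k < d" "M - 2 \<le> k" for i k
  proof -
    have "(\<Sum>n<M. new_point d c n k * (q' n * a n i - p' n * ?A (a n) i)) = 0"
      using that by (intro sum.neutral) (auto simp: new_point_def)
    then show ?thesis using split[of i k] that by simp
  qed
  from shift_independentD[OF D this] have old: "\<forall>l<s. p l = 0 \<and> q l = 0"
    by blast
  have F: "(\<Sum>n<M. q' n * a n i) = (\<Sum>n<M. p' n * ?A (a n) i)" if "i < M" for i
    using split[OF that, of d] d v by (simp add: new_point_def sum_subtractf)
  have G: "(\<Sum>n<M. (q' n * c n) * a n i) = (\<Sum>n<M. (p' n * c n) * ?A (a n) i)" if "i < M" for i
    using split[OF that, of "Suc d"] d v
    by (simp add: new_point_def sum_subtractf right_diff_distrib mult_ac)
  define z where "z = (\<lambda>i. \<Sum>n<M. p' n * a n i)"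
  have "?A (?B z) i = ?B (?A z) i" if i: "i < M" for i
  proof -
    have "?A (?B z) i = ?A (\<lambda>i. \<Sum>n<M. (p' n * c n) * a n i) i"
      unfolding z_def using i by (intro clock_shift_cong) (simp_all add: clock_shift_sum a mult_ac)
    also have "\<dots> = (\<Sum>n<M. (q' n * c n) * a n i)"
      using G[OF i] by (simp add: clock_shift_sum)
    also have "\<dots> = ?B (\<lambda>i. \<Sum>n<M. q' n * a n i) i"
      using i by (simp add: clock_shift_sum a mult_ac)
    also have "\<dots> = ?B (?A z) i"
      unfolding z_def using i F by (intro clock_shift_cong) (simp_all add: clock_shift_sum)
    finally show ?thesis .
  qed
  then have "\<forall>i<M. z i = 0"
    using clock_shift_commutator_injective[OF M \<open>\<sigma> \<noteq> \<tau>\<close>] by blast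
  then have p': "\<forall>n<M. p' n = 0"
    using ind[of p'] by (simp add: z_def)
  then have "\<forall>n<M. q' n = 0"
    using F ind[of q'] by simp
  moreover assume "l0 < s + M"
  ultimately show "p l0 = 0 \<and> q l0 = 0"
    using old p' by (cases "l0 < s") (auto simp: p'_def q'_def dest!: spec[of _ "l0 - s"])
qed

section \<open>The starting configuration\<close>

text \<open>
  If the vectors \<open>v\<^sub>l\<close> are linearly independent, as witnessed by dual functionals \<open>\<phi>\<^sub>l\<close>, and the
  \<open>u\<^sub>l\<close> are independent (here: each has a coordinate that is its own), then contracting a relation
  with \<open>\<phi>\<^sub>a\<close> in one or in both symmetric slots isolates the contribution of the point \<open>a\<close>.
\<close>

lemma tangents_independent_of_dual_functionals:
  assumes \<phi>: "\<And>a l. a < s \<Longrightarrow> l < s \<Longrightarrow> (\<Sum>k<d. \<phi> a k * v l k) = (if a = l then 1 else 0)"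
    and u: "\<And>a. a < s \<Longrightarrow> \<exists>i<M. u a i \<noteq> 0 \<and> (\<forall>b<s. b \<noteq> a \<longrightarrow> u b i = 0)"
  shows "tangents_independent M d s u v"
  unfolding tangents_independent_def
proof (intro allI impI)
  fix \<alpha> \<beta> :: "nat \<Rightarrow> nat \<Rightarrow> complex" and a
  assume rel: "\<forall>i<M. \<forall>j<d. \<forall>k<d.
    (\<Sum>l<s. \<alpha> l i * (v l j * v l k) + u l i * (v l j * \<beta> l k + \<beta> l j * v l k)) = 0"
  assume a: "a < s"
  define P where "P = (\<lambda>a l. \<Sum>k<d. \<phi> a k * \<beta> l k)"
  have contract: "\<alpha> a i * v a j + u a i * \<beta> a j + (\<Sum>l<s. u l i * P a l * v l j) = 0"
    if "a < s" "i < M" "j < d" for a i j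
  proof -
    have "0 = (\<Sum>k<d. \<phi> a k * (\<Sum>l<s. \<alpha> l i * (v l j * v l k) + u l i * (v l j * \<beta> l k + \<beta> l j * v l k)))"
      using rel that by simp
    also have "\<dots> = (\<Sum>l<s. \<Sum>k<d. \<phi> a k * (\<alpha> l i * (v l j * v l k) + u l i * (v l j * \<beta> l k + \<beta> l j * v l k)))"
      unfolding sum_distrib_left by (rule sum.swap)
    also have "\<dots> = (\<Sum>l<s. (\<alpha> l i * v l j + u l i * \<beta> l j) * (\<Sum>k<d. \<phi> a k * v l k)
        + u l i * v l j * (\<Sum>k<d. \<phi> a k * \<beta> l k))"
      unfolding sum_distrib_left sum.distrib[symmetric]
      by (intro sum.cong refl) (simp add: algebra_simps)
    also have "\<dots> = (\<Sum>l<s. (if a = l then \<alpha> l i * v l j + u l i * \<beta> l j else 0) + u l i * P a l * v l j)"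
      using \<phi> that by (intro sum.cong) (auto simp: P_def)
    also have "\<dots> = \<alpha> a i * v a j + u a i * \<beta> a j + (\<Sum>l<s. u l i * P a l * v l j)"
      unfolding sum.distrib using that by simp
    finally show ?thesis by simp
  qed
  have contract2: "(if b = a then \<alpha> a i else 0) + u a i * P b a + u b i * P a b = 0"
    if "a < s" "b < s" "i < M" for a b i
  proof -
    have "0 = (\<Sum>j<d. \<phi> b j * (\<alpha> a i * v a j + u a i * \<beta> a j + (\<Sum>l<s. u l i * P a l * v l j)))"
      using contract that by simp
    also have "\<dots> = \<alpha> a i * (\<Sum>j<d. \<phi> b j * v a j) + u a i * P b a
        + (\<Sum>j<d. \<Sum>l<s. \<phi> b j * (u l i * P a l * v l j))"
      unfolding P_def sum_distrib_left[of "\<alpha> a i"] sum_distrib_left[of "u a i"]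
      by (simp add: distrib_left sum.distrib sum_distrib_left mult_ac)
    also have "(\<Sum>j<d. \<Sum>l<s. \<phi> b j * (u l i * P a l * v l j))
        = (\<Sum>l<s. u l i * P a l * (\<Sum>j<d. \<phi> b j * v l j))"
      by (subst sum.swap) (simp add: sum_distrib_left mult_ac)
    also have "\<dots> = (\<Sum>l<s. if b = l then u l i * P a l else 0)"
      using \<phi> that by (intro sum.cong) auto
    finally show ?thesis using that by (cases "b = a") (simp_all add: \<phi> mult_ac)
  qed
  have P0: "P a l = 0" if l: "l < s" "l \<noteq> a" for l
  proof -
    obtain i where i: "i < M" "u l i \<noteq> 0" "\<forall>b<s. b \<noteq> l \<longrightarrow> u b i = 0"
      using u[OF l(1)] by blast
    then show ?thesis using contract2[of a l i] l a by simp
  qed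
  have \<alpha>: "\<alpha> a i = - 2 * P a a * u a i" if "i < M" for i
    using contract2[OF a a that] by (simp add: eq_neg_iff_add_eq_0 algebra_simps)
  have "\<beta> a j = P a a * v a j" if j: "j < d" for j
  proof -
    obtain i where i: "i < M" "u a i \<noteq> 0" using u[OF a] by blast
    have "(\<Sum>l<s. u l i * P a l * v l j) = (\<Sum>l<s. if l = a then u l i * P a l * v l j else 0)"
      using P0 by (intro sum.cong) auto
    then have "- 2 * P a a * u a i * v a j + u a i * \<beta> a j + u a i * P a a * v a j = 0"
      using contract[OF a i(1) j] \<alpha>[OF i(1)] a by simp
    moreover have "u a i * (\<beta> a j - P a a * v a j)
        = - 2 * P a a * u a i * v a j + u a i * \<beta> a j + u a i * P a a * v a j"
      by (simp add: algebra_simps)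
    ultimately have "u a i * (\<beta> a j - P a a * v a j) = 0" by (simp only:)
    then show ?thesis using i by simp
  qed
  then show "\<exists>t. (\<forall>i<M. \<alpha> a i = - 2 * t * u a i) \<and> (\<forall>k<d. \<beta> a k = t * v a k)"
    using \<alpha> by blast
qed

text \<open>
  The starting points for \<open>d = M - 1\<close>: the vector \<open>u\<^sub>l\<close> is the basis vector number \<open>2 l + 1\<close>, and
  \<open>v\<^sub>l\<close> is \<open>h\<close> for \<open>l = 0\<close> and \<open>h + e\<^bsub>l-1\<^esub>\<close> for \<open>l > 0\<close>, where \<open>h\<close> is the basis vector number
  \<open>M - 2\<close>.  Thus all \<open>v\<^sub>l\<close> with \<open>l < M div 2\<close> are equal to \<open>h\<close> modulo \<open>W\<^sub>0\<close>.
\<close>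

definition base_u :: "nat \<Rightarrow> nat \<Rightarrow> complex" where
  "base_u l i = (if i = 2 * l + 1 then 1 else 0)"

definition base_v :: "nat \<Rightarrow> nat \<Rightarrow> nat \<Rightarrow> complex" where
  "base_v M l k = (if k = M - 2 \<or> Suc k = l then 1 else 0)"

lemma tangents_independent_base:
  assumes M: "M \<ge> 2"
  shows "tangents_independent M (M - 1) (M div 2) base_u (base_v M)"
proof (rule tangents_independent_of_dual_functionals)
  define \<phi> :: "nat \<Rightarrow> nat \<Rightarrow> complex" where
    "\<phi> = (\<lambda>a k. if a = 0 then (if k = M - 2 then 1 else 0) - (if Suc k < M div 2 then 1 else 0)
       else if k = a - 1 then 1 else 0)"
  fix a l assume a: "a < M div 2" and l: "l < M div 2"
  show "(\<Sum>k<M - 1. \<phi> a k * base_v M l k) = (if a = l then 1 else 0)"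
  proof (cases "a = 0")
    case True
    have "(\<Sum>k<M - 1. \<phi> a k * base_v M l k)
        = (\<Sum>k<M - 1. (if k = M - 2 then 1 else 0) - (if k = l - 1 then if l = 0 then 0 else 1 else 0))"
      using True l by (intro sum.cong) (auto simp: \<phi>_def base_v_def)
    also have "\<dots> = 1 - (if l = 0 then 0 else 1)"
      unfolding sum_subtractf using M l by simp
    finally show ?thesis using True by simp
  next
    case False
    have "(\<Sum>k<M - 1. \<phi> a k * base_v M l k) = (\<Sum>k<M - 1. if k = a - 1 then base_v M l k else 0)"
      using False by (intro sum.cong) (auto simp: \<phi>_def)
    also have "\<dots> = base_v M l (a - 1)" using a by simp
    finally show ?thesis using False a by (auto simp: base_v_def)
  qed
next
  fix a assume "a < M div 2"
  then show "\<exists>i<M. base_u a i \<noteq> 0 \<and> (\<forall>b<M div 2. b \<noteq> a \<longrightarrow> base_u b i = 0)"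
    by (intro exI[of _ "2 * a + 1"]) (auto simp: base_u_def)
qed

text \<open>
  As \<open>X + \<sigma> N\<close> sends the basis vector number \<open>2 l + 1\<close> to a combination of the basis vectors
  number \<open>2 l + 1\<close> and \<open>2 l\<close>, the second one with coefficient \<open>\<sigma>\<close>, the different \<open>u\<^sub>l\<close> use disjoint
  pairs of coordinates.
\<close>

lemma shift_independent_base:
  assumes M: "M \<ge> 2" and \<sigma>: "\<sigma> \<noteq> 0"
  shows "shift_independent M (M - 1) \<sigma> (M div 2) base_u (base_v M)"
  unfolding shift_independent_def
proof (intro allI impI)
  fix p q :: "nat \<Rightarrow> complex" and a
  assume rel: "\<forall>i<M. \<forall>k<M - 1. M - 2 \<le> k \<longrightarrow>
    (\<Sum>l<M div 2. base_v M l k * (q l * base_u l i - p l * clock_shift M \<sigma> (base_u l) i)) = 0"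
  assume a: "a < M div 2"
  have rel': "(\<Sum>l<M div 2. q l * base_u l i - p l * clock_shift M \<sigma> (base_u l) i) = 0" if "i < M" for i
    using rel[rule_format, OF that, of "M - 2"] M by (simp add: base_v_def)
  have p: "p b = 0" if "b < M div 2" for b
  proof -
    have "(\<Sum>l<M div 2. q l * base_u l (2 * b) - p l * clock_shift M \<sigma> (base_u l) (2 * b))
      = (\<Sum>l<M div 2. if l = b then - \<sigma> * p l else 0)"
      using that by (intro sum.cong refl) (auto simp: base_u_def clock_shift_def; presburger)
    then show ?thesis using rel'[of "2 * b"] that \<sigma> by simp
  qed
  have "(\<Sum>l<M div 2. q l * base_u l (2 * a + 1) - p l * clock_shift M \<sigma> (base_u l) (2 * a + 1))
      = (\<Sum>l<M div 2. if l = a then q l else 0)"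
    using p by (intro sum.cong refl) (auto simp: base_u_def)
  then show "p a = 0 \<and> q a = 0" using rel'[of "2 * a + 1"] a p by simp
qed

section \<open>Configurations with independent tangent spaces\<close>

text \<open>
  The round that leads from \<open>R\<close> to \<open>R + 1\<close> uses the operator with \<open>\<sigma> = R + 1\<close>; the invariant about
  \<open>r > R\<close> provides for this and for all later rounds.
\<close>

lemma independent_family_exists:
  assumes M: "M \<ge> 2"
    and start: "d0 = M - 2 \<and> s0 = 0 \<or> d0 = M - 1 \<and> s0 = M div 2"
  shows "\<exists>u v. (\<forall>l<s0 + R * M. (\<exists>i<M. u l i \<noteq> 0) \<and> (\<exists>k<d0 + 2 * R. v l k \<noteq> 0) \<and> (\<forall>k\<ge>d0 + 2 * R. v l k = 0))
      \<and> tangents_independent M (d0 + 2 * R) (s0 + R * M) u v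
      \<and> (\<forall>r>R. shift_independent M (d0 + 2 * R) (of_nat r) (s0 + R * M) u v)"
proof (induction R)
  case 0
  show ?case
  proof (cases "d0 = M - 1 \<and> s0 = M div 2")
    case True
    have "(\<exists>i<M. base_u l i \<noteq> 0) \<and> (\<exists>k<M - 1. base_v M l k \<noteq> 0) \<and> (\<forall>k\<ge>M - 1. base_v M l k = 0)"
      if "l < M div 2" for l
    proof (intro conjI)
      show "\<exists>i<M. base_u l i \<noteq> 0" using that by (intro exI[of _ "2 * l + 1"]) (auto simp: base_u_def)
      show "\<exists>k<M - 1. base_v M l k \<noteq> 0" using M by (intro exI[of _ "M - 2"]) (auto simp: base_v_def)
      show "\<forall>k\<ge>M - 1. base_v M l k = 0" using that M by (auto simp: base_v_def)
    qed
    then show ?thesis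
      using True tangents_independent_base[OF M] shift_independent_base[OF M]
      by (intro exI[of _ base_u] exI[of _ "base_v M"]) auto
  next
    case False
    then show ?thesis
      using start by (auto simp: tangents_independent_def shift_independent_def)
  qed
next
  case (Suc R)
  let ?d = "d0 + 2 * R" and ?s = "s0 + R * M"
  obtain u v where nz: "\<And>l. l < ?s \<Longrightarrow> (\<exists>i<M. u l i \<noteq> 0) \<and> (\<exists>k<?d. v l k \<noteq> 0)"
    and v: "\<And>l k. l < ?s \<Longrightarrow> k \<ge> ?d \<Longrightarrow> v l k = 0"
    and T: "tangents_independent M ?d ?s u v"
    and D: "\<And>r. r > R \<Longrightarrow> shift_independent M ?d (of_nat r) ?s u v"
    using Suc.IH by blast
  have "M > 0" using M by simp
  have "real (Suc R) > 0" by simp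
  obtain c a L where c: "inj_on c {..<M}"
    and a: "\<And>j i. i < M \<Longrightarrow> clock_shift M (complex_of_real (real (Suc R))) (a j) i = c j * a j i"
    and La: "\<And>j k. j < M \<Longrightarrow> k < M \<Longrightarrow> (\<Sum>i<M. L k i * a j i) = (if j = k then 1 else 0)"
    and aL: "\<And>x i. i < M \<Longrightarrow> (\<Sum>k<M. a k i * (\<Sum>i<M. L k i * x i)) = x i"
    and LA: "\<And>x k. k < M \<Longrightarrow> (\<Sum>i<M. L k i * clock_shift M (complex_of_real (real (Suc R))) x i)
        = c k * (\<Sum>i<M. L k i * x i)"
    by (rule clock_shift_diagonalizable[OF \<open>M > 0\<close> \<open>real (Suc R) > 0\<close>]) (rule that; assumption)
  have ind: "\<forall>j<M. x j = 0" if x: "\<forall>i<M. (\<Sum>j<M. x j * a j i) = 0" for x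
  proof (intro allI impI)
    fix k assume k: "k < M"
    have "0 = (\<Sum>i<M. L k i * (\<Sum>j<M. x j * a j i))" using x by simp
    also have "\<dots> = (\<Sum>j<M. x j * (\<Sum>i<M. L k i * a j i))"
      unfolding sum_distrib_left by (subst sum.swap) (simp add: mult_ac)
    also have "\<dots> = (\<Sum>j<M. if j = k then x j else 0)"
      using La k by (intro sum.cong) auto
    finally show "x k = 0" using k by simp
  qed
  let ?u = "append_family ?s u a" and ?v = "append_family ?s v (new_point ?d c)"
  have d: "M - 2 \<le> ?d" using start by auto
  have sh: "complex_of_real (real (Suc R)) = of_nat (Suc R)" by simp
  have "tangents_independent M (?d + 2) (?s + M) ?u ?v"
    using tangents_independent_step[OF M d c La aL LA T v] D[of "Suc R"] sh by simp
  moreover have "shift_independent M (?d + 2) (of_nat r) (?s + M) ?u ?v" if "r > Suc R" for r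
  proof (rule shift_independent_step[OF M d _ a ind v])
    show "of_nat r \<noteq> complex_of_real (real (Suc R))"
      using that by (metis nat_neq_iff of_nat_eq_iff of_real_of_nat_eq)
    show "shift_independent M ?d (of_nat r) ?s u v" using that by (intro D) simp
  qed
  moreover have "(\<exists>i<M. ?u l i \<noteq> 0) \<and> (\<exists>k<?d + 2. ?v l k \<noteq> 0) \<and> (\<forall>k\<ge>?d + 2. ?v l k = 0)"
    if l: "l < ?s + M" for l
  proof (cases "l < ?s")
    case True
    obtain k where "k < ?d" "v l k \<noteq> 0" using nz[OF True] by blast
    then have "\<exists>k<?d + 2. v l k \<noteq> 0" by (intro exI[of _ k]) simp
    then show ?thesis using True nz[OF True] v[OF True] by (simp add: append_family_def)
  next
    case False
    let ?j = "l - ?s"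
    have j: "?j < M" using l False by simp
    have "\<exists>i<M. a ?j i \<noteq> 0"
    proof (rule ccontr)
      assume "\<not> (\<exists>i<M. a ?j i \<noteq> 0)"
      then have "(\<Sum>i<M. L ?j i * a ?j i) = 0" by simp
      then show False using La[OF j j] by simp
    qed
    moreover have "\<exists>k<?d + 2. new_point ?d c ?j k \<noteq> 0"
      by (intro exI[of _ ?d]) (simp add: new_point_def)
    moreover have "\<forall>k\<ge>?d + 2. new_point ?d c ?j k = 0"
      using d j by (auto simp: new_point_def)
    ultimately show ?thesis using False by (simp add: append_family_def)
  qed
  ultimately show ?case
    by (intro exI[of _ ?u] exI[of _ ?v]) (simp add: algebra_simps)
qed

section \<open>Gram determinants\<close>

lemma sum_fun_apply: "(\<Sum>l\<in>A. f l) c = (\<Sum>l\<in>A. f l c)"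
  by (induction A rule: infinite_finite_induct) simp_all

text \<open>
  The matrix of Hermitian products, over the finite set \<open>C\<close> of coordinates, of the vectors
  \<open>w'\<^sub>0, \<dots>, w'\<^bsub>N-1\<^esub>\<close> with the vectors \<open>w\<^sub>0, \<dots>, w\<^bsub>N-1\<^esub>\<close>.  It depends linearly on each \<open>w'\<^sub>p\<close>, and a
  nonzero determinant certifies that the \<open>w'\<^sub>p\<close> are linearly independent.
\<close>

definition gram :: "nat \<Rightarrow> 'c set \<Rightarrow> (nat \<Rightarrow> 'c \<Rightarrow> complex) \<Rightarrow> (nat \<Rightarrow> 'c \<Rightarrow> complex) \<Rightarrow> complex mat" where
  "gram N C w' w = mat N N (\<lambda>(p, q). \<Sum>c\<in>C. w' p c * cnj (w q c))"

lemma gram_carrier: "gram N C w' w \<in> carrier_mat N N"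
  by (simp add: gram_def)

lemma det_gram_nonzero:
  assumes "finite C"
    and ind: "\<And>x. \<forall>c\<in>C. (\<Sum>p<N. x p * w p c) = 0 \<Longrightarrow> \<forall>p<N. x p = 0"
  shows "det (gram N C w w) \<noteq> 0"
proof
  assume "det (gram N C w w) = 0"
  then obtain z where z: "z \<in> carrier_vec N" "z \<noteq> 0\<^sub>v N" "gram N C w w *\<^sub>v z = 0\<^sub>v N"
    using det_0_iff_vec_prod_zero_field[OF gram_carrier] by blast
  define f where "f = (\<lambda>c. \<Sum>p<N. cnj (z $ p) * w p c)"
  have row: "(\<Sum>c\<in>C. w p c * cnj (f c)) = 0" if p: "p < N" for p
  proof -
    have "(gram N C w w *\<^sub>v z) $ p = (\<Sum>q<N. (\<Sum>c\<in>C. w p c * cnj (w q c)) * z $ q)"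
      using p z(1) by (simp add: gram_def scalar_prod_def atLeast0LessThan)
    also have "\<dots> = (\<Sum>c\<in>C. \<Sum>q<N. w p c * (cnj (w q c) * z $ q))"
      by (simp add: sum_distrib_right mult.assoc) (rule sum.swap)
    also have "\<dots> = (\<Sum>c\<in>C. w p c * cnj (f c))"
      by (simp add: f_def sum_distrib_left mult_ac)
    finally show ?thesis using z(3) p by simp
  qed
  have "of_real (\<Sum>c\<in>C. (cmod (f c))\<^sup>2) = (\<Sum>c\<in>C. f c * cnj (f c))"
    by (simp only: of_real_sum complex_norm_square)
  also have "\<dots> = (\<Sum>c\<in>C. \<Sum>p<N. cnj (z $ p) * (w p c * cnj (f c)))"
    by (subst f_def) (simp add: sum_distrib_right mult.assoc)
  also have "\<dots> = (\<Sum>p<N. cnj (z $ p) * (\<Sum>c\<in>C. w p c * cnj (f c)))"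
    unfolding sum_distrib_left by (rule sum.swap)
  also have "\<dots> = 0" using row by simp
  finally have "(\<Sum>c\<in>C. (cmod (f c))\<^sup>2) = 0" using of_real_eq_0_iff by blast
  then have "\<forall>c\<in>C. f c = 0"
    using assms(1) by (simp add: sum_nonneg_eq_0_iff)
  then have "\<forall>p<N. cnj (z $ p) = 0" by (intro ind[of "\<lambda>p. cnj (z $ p)"]) (simp add: f_def)
  then show False using z(1,2) by (auto intro!: eq_vecI)
qed

lemma independent_if_det_gram_nonzero:
  assumes det: "det (gram N C w' w) \<noteq> 0"
    and x: "\<forall>c\<in>C. (\<Sum>p<N. x p * w' p c) = 0"
    and p: "p < N"
  shows "x p = 0"
proof -
  let ?G = "transpose_mat (gram N C w' w)"
  have G: "?G \<in> carrier_mat N N" using gram_carrier by simp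
  have "?G *\<^sub>v vec N x = 0\<^sub>v N"
  proof (intro eq_vecI)
    fix q assume "q < dim_vec (0\<^sub>v N :: complex vec)"
    then have q: "q < N" by simp
    have "(?G *\<^sub>v vec N x) $ q = (\<Sum>p<N. (\<Sum>c\<in>C. w' p c * cnj (w q c)) * x p)"
      using q by (simp add: gram_def scalar_prod_def atLeast0LessThan)
    also have "\<dots> = (\<Sum>c\<in>C. \<Sum>p<N. cnj (w q c) * (x p * w' p c))"
      by (simp add: sum_distrib_left sum_distrib_right mult_ac) (rule sum.swap)
    also have "\<dots> = (\<Sum>c\<in>C. cnj (w q c) * (\<Sum>p<N. x p * w' p c))"
      by (simp add: sum_distrib_left)
    also have "\<dots> = 0" using x by simp
    finally show "(?G *\<^sub>v vec N x) $ q = 0\<^sub>v N $ q" using q by simp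
  qed (simp add: gram_def)
  moreover have "det ?G = det (gram N C w' w)" by (rule det_transpose[OF gram_carrier])
  then have "det ?G \<noteq> 0" using det by metis
  ultimately have "vec N x = 0\<^sub>v N"
    using det_0_iff_vec_prod_zero_field[OF G] vec_carrier[of N x] by metis
  then have "vec N x $ p = 0\<^sub>v N $ p" by simp
  then show ?thesis using p by simp
qed

lemma independent_family_image:
  fixes w :: "nat \<Rightarrow> 'c \<Rightarrow> complex"
  assumes ind: "\<And>x. \<forall>c. (\<Sum>p<N. x p * w p c) = 0 \<Longrightarrow> \<forall>p<N. x p = 0"
  shows "inj_on w {..<N}" and "cfun.independent (w ` {..<N})"
proof -
  show inj: "inj_on w {..<N}"
  proof (intro inj_onI, rule ccontr)
    fix p q assume pq: "p \<in> {..<N}" "q \<in> {..<N}" "w p = w q" "p \<noteq> q"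
    define x :: "nat \<Rightarrow> complex" where "x = (\<lambda>r. (if r = p then 1 else 0) - (if r = q then 1 else 0))"
    have "(\<Sum>r<N. x r * w r c) = 0" for c
    proof -
      have "(\<Sum>r<N. x r * w r c) = (\<Sum>r<N. (if r = p then w r c else 0) - (if r = q then w r c else 0))"
        by (intro sum.cong) (auto simp: x_def)
      also have "\<dots> = w p c - w q c"
        unfolding sum_subtractf using pq by simp
      finally show ?thesis using pq by simp
    qed
    then have "x p = 0" using ind[of x] pq by simp
    then show False using pq by (simp add: x_def)
  qed
  show "cfun.independent (w ` {..<N})"
  proof
    assume "cfun.dependent (w ` {..<N})"
    then obtain g where g: "\<exists>b\<in>w ` {..<N}. g b \<noteq> 0" "(\<Sum>b\<in>w ` {..<N}. cscale (g b) b) = 0"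
      using cfun.dependent_finite[of "w ` {..<N}"] by auto
    have "(\<Sum>p<N. g (w p) * w p c) = 0" for c
    proof -
      have "(\<Sum>p<N. g (w p) * w p c) = (\<Sum>p<N. cscale (g (w p)) (w p)) c"
        by (simp add: sum_fun_apply cscale_def)
      also have "\<dots> = (\<Sum>b\<in>w ` {..<N}. cscale (g b) b) c"
        by (simp add: sum.reindex[OF inj])
      finally show ?thesis using g(2) by simp
    qed
    then have "\<forall>p<N. g (w p) = 0" by (intro ind) simp
    then show False using g(1) by auto
  qed
qed

lemma poly_funs_sum:
  assumes "\<And>a. a \<in> A \<Longrightarrow> (\<lambda>x. f a x) \<in> poly_funs m n s"
  shows "(\<lambda>x. \<Sum>a\<in>A. f a x) \<in> poly_funs m n s"
  using assms
  by (induction A rule: infinite_finite_induct) (simp_all add: poly_funs.const poly_funs.add)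

lemma poly_funs_prod:
  assumes "\<And>a. a \<in> A \<Longrightarrow> (\<lambda>x. f a x) \<in> poly_funs m n s"
  shows "(\<lambda>x. \<Prod>a\<in>A. f a x) \<in> poly_funs m n s"
  using assms
  by (induction A rule: infinite_finite_induct) (simp_all add: poly_funs.const poly_funs.mult)

lemma det_gram_poly_funs:
  assumes "\<And>p c. p < N \<Longrightarrow> c \<in> C \<Longrightarrow> (\<lambda>x. w' x p c) \<in> poly_funs m n s"
  shows "(\<lambda>x. det (gram N C (w' x) w)) \<in> poly_funs m n s"
proof -
  have "det (gram N C (w' x) w) = (\<Sum>\<pi> | \<pi> permutes {0..<N}. signof \<pi> *
      (\<Prod>p = 0..<N. \<Sum>c\<in>C. w' x p c * cnj (w (\<pi> p) c)))" for x
  proof -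
    have "\<pi> p < N" if "\<pi> permutes {0..<N}" "p < N" for \<pi> p
      using permutes_in_image[OF that(1)] that(2) by auto
    then show ?thesis
      unfolding det_def'[OF gram_carrier]
      by (intro sum.cong refl arg_cong2[of _ _ _ _ "(*)"] prod.cong) (auto simp: gram_def)
  qed
  then show ?thesis
    using assms
    by (simp only:) (intro poly_funs_sum poly_funs.mult poly_funs.const poly_funs_prod, auto)
qed

lemma det_gram_row_scale:
  "det (gram N C (\<lambda>p c. f p * w' p c) w) = (\<Prod>p<N. f p) * det (gram N C w' w)"
proof -
  have "(\<Prod>p = 0..<N. gram N C (\<lambda>p c. f p * w' p c) w $$ (p, \<pi> p))
      = (\<Prod>p<N. f p) * (\<Prod>p = 0..<N. gram N C w' w $$ (p, \<pi> p))" if "\<pi> permutes {0..<N}" for \<pi>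
  proof -
    have "\<pi> p < N" if "p < N" for p
      using permutes_in_image[OF \<open>\<pi> permutes {0..<N}\<close>] that by auto
    then show ?thesis
      unfolding atLeast0LessThan prod.distrib[symmetric]
      by (intro prod.cong) (auto simp: gram_def sum_distrib_left mult.assoc)
  qed
  then show ?thesis
    unfolding det_def'[OF gram_carrier] sum_distrib_left
    by (intro sum.cong refl) (simp add: mult_ac)
qed

section \<open>From one configuration to general points\<close>

definition coord_vec :: "nat \<Rightarrow> nat \<Rightarrow> complex" where
  "coord_vec e = (\<lambda>k. if k = e then 1 else 0)"

text \<open>
  The increasing enumeration of the natural numbers other than \<open>a\<close>.
\<close>

definition skip :: "nat \<Rightarrow> nat \<Rightarrow> nat" where
  "skip a b = (if b < a then b else Suc b)"

text \<open>
  Spanning vectors of the tangent spaces, written linearly in the tensors \<open>x\<^sub>l\<close> themselves instead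
  of the factors of \<open>x\<^sub>l = u \<otimes> v\<^sup>2\<close>.  The index \<open>p\<close> encodes a point \<open>l\<close> and a position
  \<open>e < n + 1 + m\<close> in its block.  Up to the scalars \<open>v (j\<^sub>0 l)\<close> and \<open>u (i\<^sub>0 l)\<close>, the first \<open>n + 1\<close>
  vectors of a block are the products \<open>u \<otimes> v e\<^sub>k\<close>, and the remaining \<open>m\<close> are the vectors
  \<open>e\<^sub>i \<otimes> v\<^sup>2\<close> with \<open>i \<noteq> i\<^sub>0 l\<close>.  Omitting \<open>i = i\<^sub>0 l\<close> removes the only linear relation, namely that
  \<open>u \<otimes> v\<^sup>2\<close> lies in both parts of the tangent space.
\<close>

definition tangent_row ::
    "nat \<Rightarrow> nat \<Rightarrow> (nat \<Rightarrow> nat) \<Rightarrow> (nat \<Rightarrow> nat) \<Rightarrow> (nat \<Rightarrow> tensor) \<Rightarrow> nat \<Rightarrow> tensor" where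
  "tangent_row m n i\<^sub>0 j\<^sub>0 x p = (let l = p div (n + 1 + m); e = p mod (n + 1 + m) in
     (\<lambda>(i, j, k). if e \<le> n
       then (x l (i, j, j\<^sub>0 l) * coord_vec e k + x l (i, k, j\<^sub>0 l) * coord_vec e j) / 2
       else coord_vec (skip (i\<^sub>0 l) (e - (n + 1))) i * x l (i\<^sub>0 l, j, k)))"

lemma div_mod_block:
  fixes K :: nat
  assumes "e < K"
  shows "(l * K + e) div K = l" and "(l * K + e) mod K = e"
  using assms by simp_all

lemma tangent_row_sym:
  assumes "x l = cscale b (tens u (sym_square v))" and "e \<le> n"
  shows "tangent_row m n i\<^sub>0 j\<^sub>0 x (l * (n + 1 + m) + e)
    = cscale (b * v (j\<^sub>0 l)) (tens u (sym_prod v (coord_vec e)))"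
proof -
  have "(l * (n + 1 + m) + e) div (n + 1 + m) = l" "(l * (n + 1 + m) + e) mod (n + 1 + m) = e"
    using assms(2) by (intro div_mod_block; simp)+
  then show ?thesis
    unfolding tangent_row_def Let_def using assms
    by (auto simp: fun_eq_iff cscale_def tens_def sym_prod_def field_simps)
qed

lemma tangent_row_vert:
  assumes "x l = cscale b (tens u (sym_square v))" and "e < m"
  shows "tangent_row m n i\<^sub>0 j\<^sub>0 x (l * (n + 1 + m) + (n + 1 + e))
    = cscale (b * u (i\<^sub>0 l)) (tens (coord_vec (skip (i\<^sub>0 l) e)) (sym_square v))"
proof -
  have "(l * (n + 1 + m) + (n + 1 + e)) div (n + 1 + m) = l"
    "(l * (n + 1 + m) + (n + 1 + e)) mod (n + 1 + m) = n + 1 + e"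
    using assms(2) by (intro div_mod_block; simp)+
  then show ?thesis
    unfolding tangent_row_def Let_def using assms
    by (auto simp: fun_eq_iff cscale_def tens_def sym_prod_def field_simps)
qed

lemma tangent_row_poly_funs:
  assumes i0: "\<And>l. l < s \<Longrightarrow> i\<^sub>0 l \<le> m" and j0: "\<And>l. l < s \<Longrightarrow> j\<^sub>0 l \<le> n"
    and p: "p < s * (n + 1 + m)" and c: "c \<in> {..m} \<times> {..n} \<times> {..n}"
  shows "(\<lambda>x. tangent_row m n i\<^sub>0 j\<^sub>0 x p c) \<in> poly_funs m n s"
proof -
  obtain i j k where c': "c = (i, j, k)" "i \<le> m" "j \<le> n" "k \<le> n" using c by auto
  define l where "l = p div (n + 1 + m)"
  define e where "e = p mod (n + 1 + m)"
  have l: "l < s" unfolding l_def using p by (simp add: less_mult_imp_div_less)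
  have half: "(\<lambda>x. (x l (i, j, j\<^sub>0 l) * coord_vec e k + x l (i, k, j\<^sub>0 l) * coord_vec e j) / 2)
     = (\<lambda>x. (x l (i, j, j\<^sub>0 l) * coord_vec e k + x l (i, k, j\<^sub>0 l) * coord_vec e j) * (1 / 2))"
    by simp
  have "(\<lambda>x. (x l (i, j, j\<^sub>0 l) * coord_vec e k + x l (i, k, j\<^sub>0 l) * coord_vec e j) / 2) \<in> poly_funs m n s"
    unfolding half using c' l j0[OF l] by (intro poly_funs.intros)
  moreover have "(\<lambda>x. coord_vec (skip (i\<^sub>0 l) (e - (n + 1))) i * x l (i\<^sub>0 l, j, k)) \<in> poly_funs m n s"
    using c' l i0[OF l] by (intro poly_funs.intros)
  ultimately show ?thesis
    unfolding tangent_row_def Let_def l_def[symmetric] e_def[symmetric] c'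
    by (cases "e \<le> n") simp_all
qed

lemma tangent_row_scale:
  "tangent_row m n i\<^sub>0 j\<^sub>0 (x(l := cscale b (x l))) p
   = (\<lambda>c. (if p div (n + 1 + m) = l then b else 1) * tangent_row m n i\<^sub>0 j\<^sub>0 x p c)"
  by (auto simp: tangent_row_def Let_def fun_eq_iff cscale_def algebra_simps)

lemma sum_lessThan_mult:
  fixes f :: "nat \<Rightarrow> 'a::comm_monoid_add"
  shows "(\<Sum>p<s * K. f p) = (\<Sum>l<s. \<Sum>e<K. f (l * K + e))"
  by (induction s) (simp_all add: sum_lessThan_add add.commute[of K])

lemma tangent_rows_independent:
  fixes z :: "nat \<Rightarrow> complex"
  assumes T: "tangents_independent (m + 1) (n + 1) s u v"
    and i0: "\<And>l. l < s \<Longrightarrow> i\<^sub>0 l \<le> m \<and> u l (i\<^sub>0 l) \<noteq> 0"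
    and j0: "\<And>l. l < s \<Longrightarrow> j\<^sub>0 l \<le> n \<and> v l (j\<^sub>0 l) \<noteq> 0"
    and z: "\<forall>c\<in>{..m} \<times> {..n} \<times> {..n}.
      (\<Sum>p<s * (n + 1 + m). z p * tangent_row m n i\<^sub>0 j\<^sub>0 (\<lambda>l. tens (u l) (sym_square (v l))) p c) = 0"
  shows "\<forall>p<s * (n + 1 + m). z p = 0"
proof -
  let ?K = "n + 1 + m" and ?x = "\<lambda>l. tens (u l) (sym_square (v l))"
  define \<alpha> where "\<alpha> = (\<lambda>l i. (\<Sum>b<m. z (l * ?K + (n + 1 + b)) * coord_vec (skip (i\<^sub>0 l) b) i) * u l (i\<^sub>0 l))"
  define \<beta> where "\<beta> = (\<lambda>l k. z (l * ?K + k) * v l (j\<^sub>0 l) / 2)"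
  have rel: "(\<Sum>l<s. \<alpha> l i * (v l j * v l k) + u l i * (v l j * \<beta> l k + \<beta> l j * v l k)) = 0"
    if ijk: "i < m + 1" "j < n + 1" "k < n + 1" for i j k
  proof -
    have *: "(\<Sum>e<?K. z (l * ?K + e) * tangent_row m n i\<^sub>0 j\<^sub>0 ?x (l * ?K + e) (i, j, k))
        = \<alpha> l i * (v l j * v l k) + u l i * (v l j * \<beta> l k + \<beta> l j * v l k)" for l
    proof -
      have x1: "?x l = cscale 1 (tens (u l) (sym_square (v l)))" by (simp add: cscale_def)
      have "(\<Sum>e<n + 1. z (l * ?K + e) * tangent_row m n i\<^sub>0 j\<^sub>0 ?x (l * ?K + e) (i, j, k))
        = (\<Sum>e<n + 1. (if k = e then u l i * v l j * \<beta> l e else 0) + (if j = e then u l i * v l k * \<beta> l e else 0))"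
        by (intro sum.cong refl, subst tangent_row_sym[where x = ?x and l = l, OF x1])
          (auto simp: cscale_def tens_def sym_prod_def coord_vec_def \<beta>_def)
      also have "\<dots> = u l i * (v l j * \<beta> l k + \<beta> l j * v l k)"
        by (simp only: sum.distrib sum.delta' finite_lessThan) (use ijk in \<open>simp add: algebra_simps\<close>)
      finally have 1: "(\<Sum>e<n + 1. z (l * ?K + e) * tangent_row m n i\<^sub>0 j\<^sub>0 ?x (l * ?K + e) (i, j, k))
        = u l i * (v l j * \<beta> l k + \<beta> l j * v l k)" .
      have 2: "(\<Sum>b<m. z (l * ?K + (n + 1 + b)) * tangent_row m n i\<^sub>0 j\<^sub>0 ?x (l * ?K + (n + 1 + b)) (i, j, k))
        = \<alpha> l i * (v l j * v l k)"
        unfolding \<alpha>_def sum_distrib_right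
        by (intro sum.cong refl, subst tangent_row_vert[where x = ?x and l = l, OF x1])
          (auto simp: cscale_def tens_def sym_prod_def)
      show ?thesis unfolding sum_lessThan_add[of _ "n + 1" m] 1 2 by (rule add.commute)
    qed
    have "(\<Sum>p<s * ?K. z p * tangent_row m n i\<^sub>0 j\<^sub>0 ?x p (i, j, k)) = 0"
      using z ijk by auto
    then show ?thesis unfolding sum_lessThan_mult * .
  qed
  have "z (l * ?K + e) = 0" if l: "l < s" and e: "e < ?K" for l e
  proof -
    obtain t where t: "\<And>i. i < m + 1 \<Longrightarrow> \<alpha> l i = - 2 * t * u l i"
      "\<And>k. k < n + 1 \<Longrightarrow> \<beta> l k = t * v l k"
      using tangents_independentD[OF T l rel] by metis
    have "\<alpha> l (i\<^sub>0 l) = 0"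
      unfolding \<alpha>_def by (auto simp: coord_vec_def skip_def intro!: sum.neutral)
    then have "t = 0" using t(1)[of "i\<^sub>0 l"] i0[OF l] by simp
    show ?thesis
    proof (cases "e < n + 1")
      case True
      then show ?thesis using t(2)[of e] \<open>t = 0\<close> j0[OF l] by (simp add: \<beta>_def)
    next
      case False
      then obtain b where b: "e = n + 1 + b" "b < m"
        using e by (metis add_diff_inverse_nat nat_add_left_cancel_less)
      have "\<alpha> l (skip (i\<^sub>0 l) b) = (\<Sum>b'<m. if b' = b then z (l * ?K + (n + 1 + b')) else 0) * u l (i\<^sub>0 l)"
        unfolding \<alpha>_def
        by (intro arg_cong2[of _ _ _ _ "(*)"] sum.cong refl) (auto simp: coord_vec_def skip_def split: if_splits)
      then have "\<alpha> l (skip (i\<^sub>0 l) b) = z (l * ?K + e) * u l (i\<^sub>0 l)" using b by simp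
      moreover have "skip (i\<^sub>0 l) b < m + 1" using b by (simp add: skip_def)
      ultimately show ?thesis using t(1) \<open>t = 0\<close> i0[OF l] by simp
    qed
  qed
  note zero = this
  show ?thesis
  proof (intro allI impI)
    fix p assume "p < s * ?K"
    then have "z (p div ?K * ?K + p mod ?K) = 0"
      by (intro zero less_mult_imp_div_less) simp_all
    then show "z p = 0" by (simp only: div_mult_mod_eq)
  qed
qed

lemma tangent_at_elem:
  "t \<in> tangent_at m n u v \<longleftrightarrow> (\<exists>a\<in>cspace (m + 1). \<exists>w\<in>cspace (n + 1).
     t = tens a (sym_square v) + tens u (sym_prod v w))"
  unfolding tangent_at_def by (auto simp: set_plus_def)

lemma coord_vec_expansion:
  assumes "w \<in> cspace d"
  shows "(\<Sum>e<d. w e * coord_vec e k) = w k"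
proof -
  have "(\<Sum>e<d. w e * coord_vec e k) = (\<Sum>e<d. if e = k then w e else 0)"
    by (intro sum.cong) (auto simp: coord_vec_def)
  then show ?thesis using assms by (auto simp: cspace_def)
qed

lemma nonzero_coordinate:
  assumes "w \<in> cspace d - {0}"
  obtains i where "i < d" "w i \<noteq> 0"
proof -
  obtain i where "w i \<noteq> 0" using assms by (auto simp: fun_eq_iff)
  moreover from this have "i < d" using assms by (auto simp: cspace_def not_le[symmetric])
  ultimately show ?thesis using that by blast
qed

lemma tens_sum_left:
  assumes "a \<in> cspace d"
  shows "tens a q = (\<Sum>i<d. cscale (a i) (tens (coord_vec i) q))"
proof (rule ext)
  fix c :: "nat \<times> nat \<times> nat"
  obtain i jk where c: "c = (i, jk)" by (cases c)
  have "tens a q c = (\<Sum>e<d. a e * coord_vec e i) * q jk"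
    by (simp add: c tens_def coord_vec_expansion[OF assms])
  then show "tens a q c = (\<Sum>i<d. cscale (a i) (tens (coord_vec i) q)) c"
    by (simp add: c sum_fun_apply cscale_def tens_def sum_distrib_right mult.assoc)
qed

lemma tens_sym_prod_sum:
  assumes w: "w \<in> cspace d"
  shows "tens u (sym_prod v w) = (\<Sum>e<d. cscale (w e) (tens u (sym_prod v (coord_vec e))))"
proof (rule ext)
  fix c :: "nat \<times> nat \<times> nat"
  obtain i j k where c: "c = (i, j, k)" using prod_cases3 .
  have "tens u (sym_prod v w) c = u i * ((v j * (\<Sum>e<d. w e * coord_vec e k) + v k * (\<Sum>e<d. w e * coord_vec e j)) / 2)"
    by (simp only: c tens_def sym_prod_def prod.case coord_vec_expansion[OF w])
  also have "\<dots> = (\<Sum>e<d. w e * (u i * ((v j * coord_vec e k + v k * coord_vec e j) / 2)))"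
    by (simp add: sum_distrib_left sum.distrib[symmetric] sum_divide_distrib algebra_simps add_divide_distrib)
  finally show "tens u (sym_prod v w) c = (\<Sum>e<d. cscale (w e) (tens u (sym_prod v (coord_vec e)))) c"
    by (simp add: c sum_fun_apply cscale_def tens_def sym_prod_def)
qed

text \<open>
  The open set is the non-vanishing locus of the Gram determinant \<open>F\<close> of the tangent rows against
  their values at the given configuration.  At a point of it the tangent rows form a basis of the sum
  of the tangent spaces.
\<close>

lemma T12_if_tangents_independent:
  assumes m: "m \<ge> 1"
    and T: "tangents_independent (m + 1) (n + 1) s u v"
    and u: "\<And>l. l < s \<Longrightarrow> u l \<in> cspace (m + 1) - {0}"
    and v: "\<And>l. l < s \<Longrightarrow> v l \<in> cspace (n + 1) - {0}"
    and bound: "s * (m + n + 1) \<le> (m + 1) * ((n + 2) choose 2)"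
  shows "T12 m n s"
proof -
  let ?K = "n + 1 + m"
  let ?N = "s * ?K"
  let ?C = "{..m} \<times> {..n} \<times> {..n}"
  have "\<exists>i. i \<le> m \<and> u l i \<noteq> 0" if "l < s" for l
    by (rule nonzero_coordinate[OF u[OF that]]) (metis Suc_eq_plus1 less_Suc_eq_le)
  then obtain i\<^sub>0 where i0: "\<And>l. l < s \<Longrightarrow> i\<^sub>0 l \<le> m \<and> u l (i\<^sub>0 l) \<noteq> 0" by metis
  have "\<exists>i. i \<le> n \<and> v l i \<noteq> 0" if "l < s" for l
    by (rule nonzero_coordinate[OF v[OF that]]) (metis Suc_eq_plus1 less_Suc_eq_le)
  then obtain j\<^sub>0 where j0: "\<And>l. l < s \<Longrightarrow> j\<^sub>0 l \<le> n \<and> v l (j\<^sub>0 l) \<noteq> 0" by metis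
  define row where "row = tangent_row m n i\<^sub>0 j\<^sub>0"
  define x0 where "x0 = (\<lambda>l. tens (u l) (sym_square (v l)))"
  define F where "F = (\<lambda>x. det (gram ?N ?C (row x) (row x0)))"
  have F0: "F x0 \<noteq> 0"
    unfolding F_def
  proof (rule det_gram_nonzero)
    fix z assume z: "\<forall>c\<in>?C. (\<Sum>p<?N. z p * row x0 p c) = 0"
    show "\<forall>p<?N. z p = 0"
      by (rule tangent_rows_independent[OF T i0 j0 z[unfolded row_def x0_def]])
  qed simp
  have "F \<in> poly_funs m n s"
    unfolding F_def row_def using i0 j0 by (intro det_gram_poly_funs tangent_row_poly_funs) auto
  moreover have "F (x(l := cscale c (x l))) = c ^ card ({..<?N} \<inter> {p. p div ?K = l}) * F x" for l c x
    unfolding F_def row_def tangent_row_scale det_gram_row_scale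
    by (simp add: prod.If_cases)
  ultimately have F: "F \<in> multihom_poly_funs m n s"
    unfolding multihom_poly_funs_def
    by (intro CollectI conjI exI[of _ "\<lambda>l. card ({..<?N} \<inter> {p. p div ?K = l})"]) simp_all
  define U where "U = {p \<in> {..<s} \<rightarrow>\<^sub>E segre_veronese m n. \<exists>F\<in>{F}. \<not> vanishes_at s F p}"
  have "zariski_open m n s U"
    unfolding zariski_open_def U_def using F by (intro exI[of _ "{F}"]) simp
  moreover have "U \<noteq> {}"
  proof -
    define P where "P = (\<lambda>l\<in>{..<s}. proj_point (x0 l))"
    have "P \<in> {..<s} \<rightarrow>\<^sub>E segre_veronese m n"
      unfolding P_def segre_veronese_def x0_def using u v by auto
    moreover have "\<not> vanishes_at s F P"
      unfolding vanishes_at_def using F0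
      by (auto simp: P_def proj_point_def intro!: exI[of _ x0] cfun.span_base)
    ultimately show ?thesis by (auto simp: U_def)
  qed
  moreover have "cfun.dim (\<Sum>i<s. tangent_cone m n (P i)) = ?N" if P: "P \<in> U" for P
  proof -
    have "\<exists>u' v'. u' \<in> cspace (m + 1) - {0} \<and> v' \<in> cspace (n + 1) - {0}
        \<and> P l = proj_point (tens u' (sym_square v'))" if "l < s" for l
    proof -
      have "P l \<in> segre_veronese m n" using P that unfolding U_def by (auto simp: PiE_iff)
      then show ?thesis unfolding segre_veronese_def by blast
    qed
    then obtain u' v' where u': "\<And>l. l < s \<Longrightarrow> u' l \<in> cspace (m + 1) - {0}"
      and v': "\<And>l. l < s \<Longrightarrow> v' l \<in> cspace (n + 1) - {0}"
      and Pl: "\<And>l. l < s \<Longrightarrow> P l = proj_point (tens (u' l) (sym_square (v' l)))"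
      by metis
    obtain x where x: "\<And>l. l < s \<Longrightarrow> x l \<in> P l" and Fx: "F x \<noteq> 0"
      using P unfolding U_def vanishes_at_def by auto
    have "\<exists>b. x l = cscale b (tens (u' l) (sym_square (v' l)))" if "l < s" for l
      using x[OF that] Pl[OF that] unfolding proj_point_def cfun.span_singleton by auto
    then obtain b where b: "\<And>l. l < s \<Longrightarrow> x l = cscale (b l) (tens (u' l) (sym_square (v' l)))"
      by metis
    have ind: "\<forall>p<?N. z p = 0" if "\<forall>c. (\<Sum>p<?N. z p * row x p c) = 0" for z
      using independent_if_det_gram_nonzero[OF Fx[unfolded F_def], of z] that by blast
    define B where "B = row x ` {..<?N}"
    have indB: "cfun.independent B" and cardB: "card B = ?N"
      using independent_family_image[where N = ?N and w = "row x"] ind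
      unfolding B_def by (simp_all add: card_image)
    have nz: "row x p \<noteq> 0" if "p < ?N" for p
      using indB cfun.dependent_zero[of B] that by (auto simp: B_def)
    have block: "l * ?K + e < ?N" if "l < s" "e < ?K" for l e
    proof -
      have "l * ?K + e < (l + 1) * ?K" using that by simp
      also have "\<dots> \<le> ?N" using that by (intro mult_right_mono) auto
      finally show ?thesis .
    qed
    have sym: "row x (l * ?K + e) = cscale (b l * v' l (j\<^sub>0 l)) (tens (u' l) (sym_prod (v' l) (coord_vec e)))"
      if "l < s" "e \<le> n" for l e
      unfolding row_def by (rule tangent_row_sym[where x = x and l = l, OF b[OF that(1)] that(2)])
    have vert: "row x (l * ?K + (n + 1 + e))
        = cscale (b l * u' l (i\<^sub>0 l)) (tens (coord_vec (skip (i\<^sub>0 l) e)) (sym_square (v' l)))"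
      if "l < s" "e < m" for l e
      unfolding row_def by (rule tangent_row_vert[where x = x and l = l, OF b[OF that(1)] that(2)])
    have cone: "tangent_cone m n (P l) = tangent_at m n (u' l) (v' l)" if "l < s" for l
      using tangent_cone_eq[OF u'[OF that] v'[OF that]] Pl[OF that] by simp
    \<comment> \<open>The rows at \<open>l\<close> give \<open>u' l \<otimes> v' l e\<^sub>k\<close> and \<open>e\<^sub>i \<otimes> (v' l)\<^sup>2\<close> for \<open>i \<noteq> i\<^sub>0 l\<close>, because the scalars
        in front are nonzero; the missing \<open>e\<^sub>i \<otimes> (v' l)\<^sup>2\<close> comes from \<open>u' l \<otimes> (v' l)\<^sup>2\<close>, whose coefficient
        \<open>u' l (i\<^sub>0 l)\<close> is a factor of one of these scalars, since \<open>m \<ge> 1\<close>.\<close>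
    have spanB: "tangent_at m n (u' l) (v' l) \<subseteq> cfun.span B" if l: "l < s" for l
    proof
      have z0: "cscale 0 t = 0" for t :: tensor by (simp add: cscale_def fun_eq_iff)
      have in_span: "t \<in> cfun.span B" if "row x p = cscale y t" "p < ?N" for y t p
      proof -
        have "y \<noteq> 0" using nz[OF that(2)] that(1) z0 by auto
        then have "t = cscale (inverse y) (row x p)"
          using that(1) by (simp add: cscale_def fun_eq_iff)
        moreover have "row x p \<in> cfun.span B"
          using that(2) by (intro cfun.span_base) (auto simp: B_def)
        ultimately show ?thesis by (metis cfun.span_scale)
      qed
      have sp1: "tens (u' l) (sym_prod (v' l) w) \<in> cfun.span B" if "w \<in> cspace (n + 1)" for w
        unfolding tens_sym_prod_sum[OF that]
        using in_span[OF sym[OF l] block[OF l]]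
        by (intro cfun.span_sum cfun.span_scale) auto
      have sp2: "tens (coord_vec i) (sym_square (v' l)) \<in> cfun.span B" if i: "i < m + 1" "i \<noteq> i\<^sub>0 l" for i
      proof -
        define e where "e = (if i < i\<^sub>0 l then i else i - 1)"
        have "e < m" "skip (i\<^sub>0 l) e = i" using i i0[OF l] by (auto simp: e_def skip_def)
        then show ?thesis
          using in_span[OF vert[OF l \<open>e < m\<close>] block[OF l]] by simp
      qed
      have "u' l (i\<^sub>0 l) \<noteq> 0"
      proof
        assume "u' l (i\<^sub>0 l) = 0"
        then have "row x (l * ?K + (n + 1 + 0)) = 0"
          using vert[OF l, of 0] m z0 by simp
        then show False using nz[OF block[OF l, of "n + 1 + 0"]] m by simp
      qed
      moreover have "cscale (u' l (i\<^sub>0 l)) (tens (coord_vec (i\<^sub>0 l)) (sym_square (v' l))) \<in> cfun.span B"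
      proof -
        let ?S = "\<Sum>i\<in>{..<m + 1} - {i\<^sub>0 l}. cscale (u' l i) (tens (coord_vec i) (sym_square (v' l)))"
        have "tens (u' l) (sym_square (v' l)) = (\<Sum>i<m + 1. cscale (u' l i) (tens (coord_vec i) (sym_square (v' l))))"
          using u'[OF l] by (intro tens_sum_left) simp
        also have "\<dots> = cscale (u' l (i\<^sub>0 l)) (tens (coord_vec (i\<^sub>0 l)) (sym_square (v' l))) + ?S"
          using i0[OF l] by (intro sum.remove) auto
        finally have "cscale (u' l (i\<^sub>0 l)) (tens (coord_vec (i\<^sub>0 l)) (sym_square (v' l)))
            = tens (u' l) (sym_square (v' l)) - ?S" by simp
        moreover have "tens (u' l) (sym_square (v' l)) \<in> cfun.span B"
          using v'[OF l] by (intro sp1) simp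
        moreover have "?S \<in> cfun.span B"
          using sp2 by (intro cfun.span_sum cfun.span_scale) auto
        ultimately show ?thesis by (simp only: cfun.span_diff)
      qed
      ultimately have sp3: "tens (coord_vec (i\<^sub>0 l)) (sym_square (v' l)) \<in> cfun.span B"
        using cfun.span_scale[of "cscale (u' l (i\<^sub>0 l)) (tens (coord_vec (i\<^sub>0 l)) (sym_square (v' l)))" B
            "inverse (u' l (i\<^sub>0 l))"] by simp
      have sp4: "tens a (sym_square (v' l)) \<in> cfun.span B" if "a \<in> cspace (m + 1)" for a
      proof -
        have "tens (coord_vec i) (sym_square (v' l)) \<in> cfun.span B" if "i < m + 1" for i
          using sp2[OF that] sp3 by (cases "i = i\<^sub>0 l") simp_all
        then show ?thesis
          unfolding tens_sum_left[OF that] by (intro cfun.span_sum cfun.span_scale) auto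
      qed
      fix t assume "t \<in> tangent_at m n (u' l) (v' l)"
      then show "t \<in> cfun.span B"
        unfolding tangent_at_elem using sp1 sp4 by (auto intro: cfun.span_add)
    qed
    let ?S = "\<Sum>i<s. tangent_cone m n (P i)"
    have S: "?S = {\<Sum>i<s. t i | t. \<forall>i\<in>{..<s}. t i \<in> tangent_at m n (u' i) (v' i)}"
    proof -
      have "?S = (\<Sum>i<s. tangent_at m n (u' i) (v' i))"
        using cone by (intro sum.cong) auto
      then show ?thesis by (simp add: set_sum_alt)
    qed
    have sp: "?S \<subseteq> cfun.span B"
      unfolding S using spanB by (auto intro!: cfun.span_sum)
    have in_S: "t \<in> ?S" if l: "l < s" and t: "t \<in> tangent_at m n (u' l) (v' l)" for l t
    proof -
      have "0 \<in> tangent_at m n u v" for u v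
        unfolding tangent_at_elem
        by (intro bexI[of _ 0]) (auto simp: tens_def sym_prod_def cspace_def fun_eq_iff)
      moreover have "t = (\<Sum>i<s. if i = l then t else 0)" using l by simp
      ultimately show ?thesis
        unfolding S using t by (intro CollectI exI[of _ "\<lambda>i. if i = l then t else 0"]) auto
    qed
    have "B \<subseteq> ?S"
    proof
      fix t assume "t \<in> B"
      then obtain p where p: "p < ?N" "t = row x p" by (auto simp: B_def)
      define l where "l = p div ?K"
      define e where "e = p mod ?K"
      have pe: "p = l * ?K + e" unfolding l_def e_def by (simp only: div_mult_mod_eq)
      have l: "l < s" unfolding l_def using p by (simp add: less_mult_imp_div_less)
      have e: "e < ?K" unfolding e_def by simp
      have "t \<in> tangent_at m n (u' l) (v' l)"
      proof (cases "e \<le> n")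
        case True
        show ?thesis
          unfolding tangent_at_elem p(2) pe sym[OF l True]
          by (intro bexI[of _ 0] bexI[of _ "cscale (b l * v' l (j\<^sub>0 l)) (coord_vec e)"])
            (use True in \<open>auto simp: tens_def sym_prod_def cspace_def cscale_def coord_vec_def fun_eq_iff algebra_simps\<close>)
      next
        case False
        then obtain f where f: "e = n + 1 + f" "f < m"
          using e by (metis Suc_eq_plus1 add_diff_inverse_nat nat_add_left_cancel_less not_less_eq_eq less_Suc_eq_le)
        have "skip (i\<^sub>0 l) f < m + 1" using f by (simp add: skip_def)
        then show ?thesis
          unfolding tangent_at_elem p(2) pe f(1) vert[OF l f(2)]
          by (intro bexI[of _ "cscale (b l * u' l (i\<^sub>0 l)) (coord_vec (skip (i\<^sub>0 l) f))"] bexI[of _ 0])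
            (auto simp: tens_def sym_prod_def cspace_def cscale_def coord_vec_def fun_eq_iff algebra_simps)
      qed
      then show "t \<in> ?S" by (rule in_S[OF l])
    qed
    then show ?thesis using cfun.dim_unique[OF _ sp indB cardB] by blast
  qed
  moreover have "min (s * (m + n + 1)) ((m + 1) * ((n + 2) choose 2)) = ?N"
    using bound by (simp add: min_absorb1 add_ac)
  ultimately show ?thesis
    unfolding T12_def for_general_points_def by metis
qed

section \<open>The number of points\<close>

lemma r_bound_ge:
  assumes "m \<ge> 1" "real n > r_bound m n"
  shows "m \<le> n + 1"
proof (cases "m = 1")
  case False
  then have m: "real m \<ge> 2" using assms(1) by simp
  have "real m - 2 \<le> r_bound m n"
  proof (cases "even m \<and> odd n")
    case True
    have "real m * (real m * real m) \<ge> real m * (2 * 2)"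
      using m by (intro mult_left_mono mult_mono) auto
    then have "real m ^ 3 \<ge> 4 * real m" by (simp add: power3_eq_cube)
    then show ?thesis using True m by (simp add: r_bound_def)
  next
    case False
    have "(real m + 1)\<^sup>2 \<ge> 3\<^sup>2" using m by (intro power_mono) auto
    then have "(real m + 1)\<^sup>2 \<ge> 2" by simp
    then have "(real m - 2) * (real m + 1)\<^sup>2 \<ge> (real m - 2) * 2"
      using m by (intro mult_left_mono) auto
    moreover have "r_bound m n = (real m - 2) * (real m + 1)\<^sup>2 / 2"
      using False by (auto simp: r_bound_def)
    ultimately show ?thesis by simp
  qed
  then have "real m < real (n + 2)" using assms(2) by simp
  then show ?thesis by linarith
qed (use assms in simp)

text \<open>
  An integer \<open>s > (m + 1)(n + 2 - m) / 2\<close> exceeds this number by at least \<open>1/2\<close>, and by at least \<open>1\<close> if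
  \<open>(m + 1)(n + 2 - m)\<close> is even.  The hypothesis on \<open>n\<close> says in either case that
  \<open>(m + 1)(n + 2 choose 2) / (m + n + 1)\<close> exceeds it by less.
\<close>

lemma max_points_bound:
  fixes m n s :: nat
  assumes m: "m \<ge> 1" and n: "real n > r_bound m n"
    and s: "s * (m + n + 1) \<le> (m + 1) * ((n + 2) choose 2)"
  shows "2 * s \<le> (m + 1) * (n + 2 - m)"
proof (rule ccontr)
  assume "\<not> ?thesis"
  then have gt: "2 * s \<ge> (m + 1) * (n + 2 - m) + 1" by simp
  have mn: "m \<le> n + 1" by (rule r_bound_ge[OF m n])
  define M where "M = real m"
  define S where "S = real s"
  define N where "N = real n"
  have ch: "2 * real ((n + 2) choose 2) = (N + 2) * (N + 1)"
  proof -
    have "2 * ((n + 2) choose 2) = (n + 2) * (n + 1)"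
      by (simp add: choose_two)
    then have "real (2 * ((n + 2) choose 2)) = real ((n + 2) * (n + 1))" by simp
    then show ?thesis by (simp add: N_def algebra_simps)
  qed
  have "real (s * (m + n + 1)) \<le> real ((m + 1) * ((n + 2) choose 2))" using s by (simp only: of_nat_le_iff)
  then have "2 * (S * (M + N + 1)) \<le> (M + 1) * (2 * real ((n + 2) choose 2))"
    by (simp add: S_def M_def N_def algebra_simps)
  then have le: "2 * (S * (M + N + 1)) \<le> (M + 1) * ((N + 2) * (N + 1))" by (simp only: ch)
  \<comment> \<open>Division of \<open>(M + 1)(N + 2)(N + 1)\<close> by \<open>M + N + 1\<close>; here \<open>M\<close> stands for \<open>m\<close>.\<close>
  have key: "(M + 1) * ((N + 2) * (N + 1)) = (M + 1) * (N + 2 - M) * (M + N + 1) + (M + 1) * M * (M - 1)"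
    by (simp add: algebra_simps)
  have pos: "M + N + 1 > 0" by (simp add: M_def N_def)
  have diff: "real (n + 2 - m) = N + 2 - M"
    using mn by (simp add: of_nat_diff N_def M_def)
  have cast: "real ((m + 1) * (n + 2 - m) + k) = (M + 1) * (N + 2 - M) + real k" for k
    unfolding of_nat_add of_nat_mult diff by (simp add: M_def)
  have gtr: "2 * S \<ge> (M + 1) * (N + 2 - M) + 1"
  proof -
    have "real (2 * s) \<ge> real ((m + 1) * (n + 2 - m) + 1)" using gt by (simp only: of_nat_le_iff)
    then show ?thesis unfolding cast by (simp add: S_def)
  qed
  have excess: "k * (M + N + 1) \<le> (M + 1) * M * (M - 1)" if "2 * S \<ge> (M + 1) * (N + 2 - M) + k" for k
  proof -
    have "((M + 1) * (N + 2 - M) + k) * (M + N + 1) \<le> 2 * S * (M + N + 1)"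
      using that pos by (intro mult_right_mono) auto
    then show ?thesis using le key by (simp add: algebra_simps)
  qed
  show False
  proof (cases "even m \<and> odd n")
    case True
    then have "N > M ^ 3 - 2 * M" using n by (simp add: r_bound_def M_def N_def)
    moreover have "1 * (M + N + 1) \<le> (M + 1) * M * (M - 1)" using excess[OF gtr] .
    then have "M + N + 1 \<le> M ^ 3 - M" by (simp add: algebra_simps power3_eq_cube)
    ultimately show False by simp
  next
    case False
    have "even ((m + 1) * (n + 2 - m))" using False mn by auto
    then have "2 * s \<ge> (m + 1) * (n + 2 - m) + 2" using gt by presburger
    then have "real (2 * s) \<ge> real ((m + 1) * (n + 2 - m) + 2)" by (simp only: of_nat_le_iff)
    then have "2 * S \<ge> (M + 1) * (N + 2 - M) + 2"
      unfolding cast by (simp add: S_def)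
    then have "2 * (M + N + 1) \<le> (M + 1) * M * (M - 1)" by (rule excess)
    moreover have "r_bound m n = (M - 2) * (M + 1)\<^sup>2 / 2"
      using False by (auto simp: r_bound_def M_def)
    then have "2 * N > (M - 2) * (M + 1)\<^sup>2"
      using n by (simp add: N_def)
    ultimately show False by (simp add: algebra_simps power2_eq_square)
  qed
qed

section \<open>Expected dimension\<close>

theorem corollary3p14:
  fixes m n :: nat
  assumes "m \<ge> 1"
    and "real n > r_bound m n"
  shows "\<forall>s::nat. int s \<le> \<lfloor>real ((m + 1) * ((n + 2) choose 2)) / real (m + n + 1)\<rfloor>
           \<longrightarrow> T12 m n s"
proof (intro allI impI)
  fix s :: nat
  assume s: "int s \<le> \<lfloor>real ((m + 1) * ((n + 2) choose 2)) / real (m + n + 1)\<rfloor>"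
  have pos: "real (m + n + 1) > 0" by simp
  have "real s \<le> real ((m + 1) * ((n + 2) choose 2)) / real (m + n + 1)"
    using s by (simp only: le_floor_iff of_int_of_nat_eq)
  then have "real s * real (m + n + 1) \<le> real ((m + 1) * ((n + 2) choose 2))"
    by (simp only: pos_le_divide_eq[OF pos])
  then have count: "s * (m + n + 1) \<le> (m + 1) * ((n + 2) choose 2)"
    by (simp only: of_nat_mult[symmetric] of_nat_le_iff)
  have mn: "m \<le> n + 1" by (rule r_bound_ge[OF assms])
  have s2: "2 * s \<le> (m + 1) * (n + 2 - m)" by (rule max_points_bound[OF assms count])
  define R where "R = (n + 2 - m) div 2"
  define d0 where "d0 = (if even (n + 2 - m) then m - 1 else m)"
  define s0 where "s0 = (if even (n + 2 - m) then 0 else (m + 1) div 2)"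
  have start: "d0 = m + 1 - 2 \<and> s0 = 0 \<or> d0 = m + 1 - 1 \<and> s0 = (m + 1) div 2"
    by (auto simp: d0_def s0_def)
  have half: "n + 2 - m = 2 * R + (if even (n + 2 - m) then 0 else 1)"
    unfolding R_def by presburger
  then have d: "d0 + 2 * R = n + 1"
    using mn assms(1) by (auto simp: d0_def split: if_splits)
  have "2 * s \<le> 2 * (R * (m + 1)) + (if even (n + 2 - m) then 0 else m + 1)"
    using s2 unfolding half[THEN arg_cong[where f = "\<lambda>x. (m + 1) * x"]] by (simp add: algebra_simps split: if_splits)
  then have le: "s \<le> s0 + R * (m + 1)"
    by (simp add: s0_def split: if_splits)
  obtain u v where uv: "\<And>l. l < s0 + R * (m + 1) \<Longrightarrow>
      (\<exists>i<m + 1. u l i \<noteq> 0) \<and> (\<exists>k<n + 1. v l k \<noteq> 0) \<and> (\<forall>k\<ge>n + 1. v l k = 0)"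
    and T: "tangents_independent (m + 1) (n + 1) (s0 + R * (m + 1)) u v"
    using independent_family_exists[of "m + 1" d0 s0 R, OF _ start] assms(1) unfolding d by auto
  \<comment> \<open>The eigenvectors are not required to vanish in the coordinates beyond \<open>m\<close>.\<close>
  define u' where "u' = (\<lambda>l i. if i < m + 1 then u l i else 0)"
  show "T12 m n s"
  proof (rule T12_if_tangents_independent[OF assms(1) _ _ _ count])
    show "tangents_independent (m + 1) (n + 1) s u' v"
      by (rule tangents_independent_restrict[OF T le]) (simp add: u'_def)
    fix l assume "l < s"
    then have l: "l < s0 + R * (m + 1)" using le by simp
    show "u' l \<in> cspace (m + 1) - {0}"
      using uv[OF l] by (auto simp: u'_def cspace_def fun_eq_iff)
    show "v l \<in> cspace (n + 1) - {0}"
      using uv[OF l] by (auto simp: cspace_def fun_eq_iff)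
  qed
qed

end
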